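(* Let $n$ be a positive integer or $n=\infty$, and let $T=(T_1,\ldots,T_n)$ be an $n$-tuple of non-zero bounded operators on a Hilbert space $\mathcal H$ with $\sum_{i=1}^nT_iT_i^*\le I_{\mathcal H}$. Then every minimal partially isometric dilation of $T$ is fully coisometric if and only if $\sum_{i=1}^nT_iT_i^*=I_{\mathcal H}$.
   Context: Infinite sums of operators are in the strong operator topology; $\vee$ denotes closed linear span. Relations $(\dagger)$: an $n$-tuple $S=(S_1,\ldots,S_n)$ of non-zero operators on a Hilbert space $\mathcal K$ satisfies $(\dagger)$ if (1) $(S_i^*S_i)^2=S_i^*S_i$ for all $i$; (2) $\sum_iS_iS_i^*\le I$; (3) for all $i,j$, either $(S_i^*S_i)(S_j^*S_j)=0$ or $S_i^*S_i=S_j^*S_j$; (4) for every $i$ there is $j$ with $S_iS_i^*\le S_j^*S_j$; (5) if $\{Q_k\}$ are the distinct elements of $\{S_i^*S_i\}$, then $\sum_kQ_k=I$. Fully coisometric: $S$ satisfying $(\dagger)$ is fully coisometric if $\sum_{i=1}^nS_iS_i^*=I_{\mathcal K}$. Minimal partially isometric dilation of $T$: an $n$-tuple $S=(S_1,\ldots,S_n)$ on a Hilbert space $\mathcal K\supseteq\mathcal H$ such that (i) $S$ satisfies $(\dagger)$; (ii) $\mathcal H$ reduces each $S_i^*S_i$, and is invariant for each $S_i^*$ with $S_i^*|_{\mathcal H}=T_i^*$; (iii) $\mathcal K=\mathcal H\vee\bigl(\bigvee_{i_1,\ldots,i_k;\,k\ge1}S_{i_1}\cdots S_{i_k}\mathcal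 H\bigr)$. *)

theory Defs
  imports "HOL-Analysis.Analysis" "HOL-Library.Extended_Nat"
begin

section \<open>Complex Hilbert spaces\<close>

text \<open>
  A complex inner product space is a real inner product space (so that norm, topology and
  completeness are those of the library) together with a complex scalar multiplication and
  a sesquilinear form whose real part is the real inner product.  The complex inner product is
  linear in the first argument.
\<close>

class complex_inner = real_inner +
  fixes scaleC :: "complex \<Rightarrow> 'a \<Rightarrow> 'a" (infixr "*\<^sub>C" 75)
    and cinner :: "'a \<Rightarrow> 'a \<Rightarrow> complex"
  assumes scaleC_add_right: "c *\<^sub>C (x + y) = c *\<^sub>C x + c *\<^sub>C y"
    and scaleC_add_left: "(c + d) *\<^sub>C x = c *\<^sub>C x + d *\<^sub>C x"
    and scaleC_scaleC: "c *\<^sub>C (d *\<^sub>C x) = (c * d) *\<^sub>C x"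
    and scaleC_of_real: "complex_of_real r *\<^sub>C x = r *\<^sub>R x"
    and cinner_commute: "cinner x y = cnj (cinner y x)"
    and cinner_add_left: "cinner (x + y) z = cinner x z + cinner y z"
    and cinner_scaleC_left: "cinner (c *\<^sub>C x) y = c * cinner x y"
    and Re_cinner: "Re (cinner x y) = inner x y"

class chilbert_space = complex_inner + complete_space

lemma Im_cinner: "Im (cinner x y) = inner ((- \<i>) *\<^sub>C x) y"
  for x y :: "'a::complex_inner"
  by (simp add: cinner_scaleC_left flip: Re_cinner)

lemma cinner_self: "cinner x x = complex_of_real ((norm x)\<^sup>2)"
  for x :: "'a::complex_inner"
proof -
  have "Im (cinner x x) = 0"
    using cinner_commute[of x x] by (metis Im_complex_of_real Reals_cnj_iff complex_is_Real_iff)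
  then show ?thesis
    by (simp add: complex_eq_iff Re_cinner power2_norm_eq_inner)
qed

lemma norm_scaleC: "norm (c *\<^sub>C x) = cmod c * norm x"
  for x :: "'a::complex_inner"
proof -
  have "complex_of_real ((norm (c *\<^sub>C x))\<^sup>2) = c * cnj c * cinner x x"
    unfolding cinner_self[symmetric]
    by (subst cinner_scaleC_left, subst cinner_commute, subst cinner_scaleC_left)
       (simp add: cinner_self)
  also have "\<dots> = complex_of_real ((cmod c * norm x)\<^sup>2)"
    using complex_norm_square[of c] by (simp add: cinner_self power_mult_distrib)
  finally have "(norm (c *\<^sub>C x))\<^sup>2 = (cmod c * norm x)\<^sup>2"
    using of_real_eq_iff by blast
  then show ?thesis by simp
qed

instantiation complex :: chilbert_space
begin
definition scaleC_complex :: "complex \<Rightarrow> complex \<Rightarrow> complex" where "scaleC_complex = (*)"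
definition cinner_complex :: "complex \<Rightarrow> complex \<Rightarrow> complex" where "cinner_complex x y = x * cnj y"
instance
  by standard
    (auto simp: scaleC_complex_def cinner_complex_def algebra_simps scaleR_conv_of_real
      inner_complex_def)
end

instantiation prod :: (complex_inner, complex_inner) complex_inner
begin
definition scaleC_prod :: "complex \<Rightarrow> 'a \<times> 'b \<Rightarrow> 'a \<times> 'b" where
  "scaleC_prod c p = (c *\<^sub>C fst p, c *\<^sub>C snd p)"
definition cinner_prod :: "'a \<times> 'b \<Rightarrow> 'a \<times> 'b \<Rightarrow> complex" where
  "cinner_prod p q = cinner (fst p) (fst q) + cinner (snd p) (snd q)"
instance
proof
  fix x y :: "'a \<times> 'b"
  show "cinner x y = cnj (cinner y x)"
    unfolding cinner_prod_def
    by (subst cinner_commute, subst (2) cinner_commute) simp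
qed (auto simp: scaleC_prod_def cinner_prod_def scaleC_add_right scaleC_add_left scaleC_scaleC
      scaleC_of_real cinner_add_left cinner_scaleC_left Re_cinner inner_prod_def algebra_simps)
end

instance prod :: (chilbert_space, chilbert_space) chilbert_space ..


section \<open>Square-summable sequences of vectors\<close>

typedef (overloaded) 'a ell2 = "{f :: nat \<Rightarrow> 'a::real_inner. summable (\<lambda>n. (norm (f n))\<^sup>2)}"
  morphisms ell2_nth Abs_ell2
  by (rule exI[of _ "\<lambda>_. 0"]) simp

setup_lifting type_definition_ell2

lemma square_summable_add:
  fixes f g :: "nat \<Rightarrow> 'a::real_inner"
  assumes "summable (\<lambda>n. (norm (f n))\<^sup>2)" "summable (\<lambda>n. (norm (g n))\<^sup>2)"
  shows "summable (\<lambda>n. (norm (f n + g n))\<^sup>2)"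
proof (rule summable_comparison_test')
  show "summable (\<lambda>n. 2 * (norm (f n))\<^sup>2 + 2 * (norm (g n))\<^sup>2)"
    by (intro summable_add summable_mult assms)
  show "norm ((norm (f n + g n))\<^sup>2) \<le> 2 * (norm (f n))\<^sup>2 + 2 * (norm (g n))\<^sup>2" for n
  proof -
    have "(norm (f n + g n))\<^sup>2 \<le> (norm (f n) + norm (g n))\<^sup>2"
      by (intro power_mono norm_triangle_ineq) auto
    also have "\<dots> \<le> 2 * (norm (f n))\<^sup>2 + 2 * (norm (g n))\<^sup>2"
      using zero_le_power2[of "norm (f n) - norm (g n)"]
      by (simp add: power2_eq_square algebra_simps)
    finally show ?thesis by simp
  qed
qed

lemma square_summable_inner:
  fixes f g :: "nat \<Rightarrow> 'a::real_inner"
  assumes "summable (\<lambda>n. (norm (f n))\<^sup>2)" "summable (\<lambda>n. (norm (g n))\<^sup>2)"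
  shows "summable (\<lambda>n. inner (f n) (g n))"
proof (rule summable_comparison_test')
  show "summable (\<lambda>n. (norm (f n))\<^sup>2 + (norm (g n))\<^sup>2)"
    by (intro summable_add assms)
  show "norm (inner (f n) (g n)) \<le> (norm (f n))\<^sup>2 + (norm (g n))\<^sup>2" for n
  proof -
    have "norm (inner (f n) (g n)) \<le> norm (f n) * norm (g n)"
      using Cauchy_Schwarz_ineq2 by auto
    moreover have "0 \<le> norm (f n) * norm (g n)" by simp
    ultimately show ?thesis
      using zero_le_power2[of "norm (f n) - norm (g n)"]
      unfolding power2_diff by linarith
  qed
qed

instantiation ell2 :: (real_inner) real_vector
begin
lift_definition zero_ell2 :: "'a ell2" is "\<lambda>_. 0" by simp
lift_definition plus_ell2 :: "'a ell2 \<Rightarrow> 'a ell2 \<Rightarrow> 'a ell2" is "\<lambda>f g n. f n + g n"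
  by (simp add: square_summable_add)
lift_definition uminus_ell2 :: "'a ell2 \<Rightarrow> 'a ell2" is "\<lambda>f n. - f n" by simp
lift_definition minus_ell2 :: "'a ell2 \<Rightarrow> 'a ell2 \<Rightarrow> 'a ell2" is "\<lambda>f g n. f n - g n"
  subgoal for f g using square_summable_add[of f "\<lambda>n. - g n"] by simp
  done
lift_definition scaleR_ell2 :: "real \<Rightarrow> 'a ell2 \<Rightarrow> 'a ell2" is "\<lambda>r f n. r *\<^sub>R f n"
  by (simp add: power_mult_distrib summable_mult)
instance
proof
  fix x y z :: "'a ell2" and r s :: real
  show "x + y + z = x + (y + z)" by transfer (simp add: add.assoc)
  show "x + y = y + x" by transfer (simp add: add.commute)
  show "0 + x = x" by transfer simp
  show "- x + x = 0" by transfer simp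
  show "x - y = x + - y" by transfer simp
  show "r *\<^sub>R (x + y) = r *\<^sub>R x + r *\<^sub>R y" by transfer (simp add: scaleR_right_distrib)
  show "(r + s) *\<^sub>R x = r *\<^sub>R x + s *\<^sub>R x" by transfer (simp add: scaleR_left_distrib)
  show "r *\<^sub>R s *\<^sub>R x = (r * s) *\<^sub>R x" by transfer simp
  show "1 *\<^sub>R x = x" by transfer simp
qed
end

instantiation ell2 :: (real_inner) real_inner
begin
lift_definition inner_ell2 :: "'a ell2 \<Rightarrow> 'a ell2 \<Rightarrow> real" is "\<lambda>f g. \<Sum>n. inner (f n) (g n)" .
definition norm_ell2 :: "'a ell2 \<Rightarrow> real" where "norm_ell2 x = sqrt (inner x x)"
definition dist_ell2 :: "'a ell2 \<Rightarrow> 'a ell2 \<Rightarrow> real" where "dist_ell2 x y = norm (x - y)"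
definition sgn_ell2 :: "'a ell2 \<Rightarrow> 'a ell2" where "sgn_ell2 x = x /\<^sub>R norm x"
definition uniformity_ell2 :: "('a ell2 \<times> 'a ell2) filter" where
  "uniformity_ell2 = (INF e\<in>{0<..}. principal {(x, y). dist x y < e})"
definition open_ell2 :: "'a ell2 set \<Rightarrow> bool" where
  "open_ell2 U \<longleftrightarrow> (\<forall>x\<in>U. eventually (\<lambda>(x', y). x' = x \<longrightarrow> y \<in> U) uniformity)"

instance
proof
  fix x y z :: "'a ell2" and r :: real
  show "inner x y = inner y x" by transfer (simp add: inner_commute)
  show "inner (x + y) z = inner x z + inner y z"
    by transfer (simp add: inner_add_left suminf_add square_summable_inner)
  show "inner (r *\<^sub>R x) y = r * inner x y"
    by transfer (simp add: suminf_mult square_summable_inner)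
  show "0 \<le> inner x x"
    by transfer (simp add: suminf_nonneg square_summable_inner)
  show "(inner x x = 0) = (x = 0)"
    by transfer (auto simp: suminf_eq_zero_iff square_summable_inner fun_eq_iff)
  show "norm x = sqrt (inner x x)" by (rule norm_ell2_def)
  show "dist x y = norm (x - y)" by (rule dist_ell2_def)
  show "sgn x = x /\<^sub>R norm x" by (rule sgn_ell2_def)
  show "(uniformity :: ('a ell2 \<times> 'a ell2) filter) =
      (INF e\<in>{0<..}. principal {(x, y). dist x y < e})"
    by (rule uniformity_ell2_def)
  show "open U = (\<forall>x\<in>U. eventually (\<lambda>(x', y). x' = x \<longrightarrow> y \<in> U) uniformity)"
    for U :: "'a ell2 set"
    by (rule open_ell2_def)
qed
end

lemma norm_ell2_sq: "(norm x)\<^sup>2 = (\<Sum>n. (norm (ell2_nth x n))\<^sup>2)"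
  for x :: "'a::real_inner ell2"
  unfolding power2_norm_eq_inner by transfer (simp add: power2_norm_eq_inner)

lemma ell2_nth_summable: "summable (\<lambda>n. (norm (ell2_nth x n))\<^sup>2)"
  for x :: "'a::real_inner ell2"
  using ell2_nth[of x] by simp

lemma sum_le_norm_ell2: "(\<Sum>k<M. (norm (ell2_nth x k))\<^sup>2) \<le> (norm x)\<^sup>2"
  for x :: "'a::real_inner ell2"
  unfolding norm_ell2_sq by (rule sum_le_suminf[OF ell2_nth_summable]) auto

lemma norm_ell2_nth_le: "norm (ell2_nth x k) \<le> norm x"
  for x :: "'a::real_inner ell2"
proof -
  have "(norm (ell2_nth x k))\<^sup>2 \<le> (\<Sum>k<Suc k. (norm (ell2_nth x k))\<^sup>2)"
    by (simp add: sum_nonneg)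
  also have "\<dots> \<le> (norm x)\<^sup>2" by (rule sum_le_norm_ell2)
  finally show ?thesis by simp
qed

instance ell2 :: ("{real_inner, complete_space}") complete_space
proof
  fix X :: "nat \<Rightarrow> 'a ell2"
  assume X: "Cauchy X"
  have nth_diff: "ell2_nth (x - y) k = ell2_nth x k - ell2_nth y k" for x y :: "'a ell2" and k
    by transfer simp
  have "Cauchy (\<lambda>m. ell2_nth (X m) k)" for k
  proof (rule metric_CauchyI)
    fix e :: real assume "e > 0"
    then obtain M where M: "\<forall>m\<ge>M. \<forall>n\<ge>M. dist (X m) (X n) < e"
      using metric_CauchyD[OF X] by blast
    have "dist (ell2_nth (X m) k) (ell2_nth (X n) k) \<le> dist (X m) (X n)" for m n
      using norm_ell2_nth_le[of "X m - X n" k] by (simp add: dist_norm nth_diff)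
    then show "\<exists>M. \<forall>m\<ge>M. \<forall>n\<ge>M. dist (ell2_nth (X m) k) (ell2_nth (X n) k) < e"
      using M by (meson order_le_less_trans)
  qed
  then have "\<forall>k. \<exists>l. (\<lambda>m. ell2_nth (X m) k) \<longlonglongrightarrow> l"
    using Cauchy_convergent unfolding convergent_def by blast
  from choice[OF this] obtain f where f: "\<And>k. (\<lambda>m. ell2_nth (X m) k) \<longlonglongrightarrow> f k"
    by blast
  have part: "\<exists>M. \<forall>m\<ge>M. summable (\<lambda>k. (norm (ell2_nth (X m) k - f k))\<^sup>2) \<and>
      (\<Sum>k. (norm (ell2_nth (X m) k - f k))\<^sup>2) \<le> e\<^sup>2" if "e > 0" for e
  proof -
    obtain M where M: "\<forall>m\<ge>M. \<forall>n\<ge>M. dist (X m) (X n) < e"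
      using metric_CauchyD[OF X \<open>e > 0\<close>] by blast
    have fin: "(\<Sum>k<N. (norm (ell2_nth (X m) k - f k))\<^sup>2) \<le> e\<^sup>2" if "m \<ge> M" for m N
    proof (rule LIMSEQ_le_const2)
      show "(\<lambda>n. \<Sum>k<N. (norm (ell2_nth (X m) k - ell2_nth (X n) k))\<^sup>2)
          \<longlonglongrightarrow> (\<Sum>k<N. (norm (ell2_nth (X m) k - f k))\<^sup>2)"
        by (intro tendsto_intros f)
      have "(\<Sum>k<N. (norm (ell2_nth (X m) k - ell2_nth (X n) k))\<^sup>2) \<le> e\<^sup>2" if "n \<ge> M" for n
      proof -
        have "(\<Sum>k<N. (norm (ell2_nth (X m) k - ell2_nth (X n) k))\<^sup>2) \<le> (norm (X m - X n))\<^sup>2"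
          using sum_le_norm_ell2[of "X m - X n" N] by (simp add: nth_diff)
        also have "\<dots> \<le> e\<^sup>2"
          using M \<open>m \<ge> M\<close> that by (intro power_mono) (auto simp: dist_norm intro: less_imp_le)
        finally show ?thesis .
      qed
      then show "\<exists>M. \<forall>n\<ge>M. (\<Sum>k<N. (norm (ell2_nth (X m) k - ell2_nth (X n) k))\<^sup>2) \<le> e\<^sup>2"
        by blast
    qed
    have "summable (\<lambda>k. (norm (ell2_nth (X m) k - f k))\<^sup>2)" if "m \<ge> M" for m
      using fin[OF that] by (intro summableI_nonneg_bounded) auto
    then show ?thesis
      using fin by (intro exI[of _ M]) (auto intro: suminf_le_const)
  qed
  obtain M0 where M0: "summable (\<lambda>k. (norm (ell2_nth (X M0) k - f k))\<^sup>2)"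
    using part[of 1] by auto
  have "summable (\<lambda>k. (norm (f k))\<^sup>2)"
    using square_summable_add[OF ell2_nth_summable[of "X M0"], of "\<lambda>k. f k - ell2_nth (X M0) k"] M0
    by (simp add: norm_minus_commute)
  then have nth: "ell2_nth (Abs_ell2 f) = f"
    by (intro Abs_ell2_inverse) simp
  have "X \<longlonglongrightarrow> Abs_ell2 f"
  proof (rule metric_LIMSEQ_I)
    fix e :: real assume "e > 0"
    then obtain M where M: "\<And>m. m \<ge> M \<Longrightarrow> (\<Sum>k. (norm (ell2_nth (X m) k - f k))\<^sup>2) \<le> (e/2)\<^sup>2"
      using part[of "e/2"] by auto
    have "dist (X m) (Abs_ell2 f) < e" if "m \<ge> M" for m
    proof -
      have "(norm (X m - Abs_ell2 f))\<^sup>2 \<le> (e/2)\<^sup>2"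
        unfolding norm_ell2_sq using M[OF that] by (simp add: nth_diff nth)
      then have "norm (X m - Abs_ell2 f) \<le> e/2"
        using \<open>e > 0\<close> by (simp add: power2_le_iff_abs_le)
      then show ?thesis using \<open>e > 0\<close> by (simp add: dist_norm)
    qed
    then show "\<exists>M. \<forall>m\<ge>M. dist (X m) (Abs_ell2 f) < e" by blast
  qed
  then show "convergent X" by (auto simp: convergent_def)
qed

lemma square_summable_scaleC:
  fixes f :: "nat \<Rightarrow> 'a::complex_inner"
  assumes "summable (\<lambda>n. (norm (f n))\<^sup>2)"
  shows "summable (\<lambda>n. (norm (c *\<^sub>C f n))\<^sup>2)"
  using assms by (simp add: norm_scaleC power_mult_distrib summable_mult)

lemma square_summable_cinner:
  fixes f g :: "nat \<Rightarrow> 'a::complex_inner"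
  assumes "summable (\<lambda>n. (norm (f n))\<^sup>2)" "summable (\<lambda>n. (norm (g n))\<^sup>2)"
  shows "summable (\<lambda>n. cinner (f n) (g n))"
  unfolding summable_complex_iff Re_cinner Im_cinner
  by (intro conjI square_summable_inner square_summable_scaleC assms)

lemma suminf_cinner_commute:
  fixes f g :: "nat \<Rightarrow> 'a::complex_inner"
  assumes "summable (\<lambda>n. (norm (f n))\<^sup>2)" "summable (\<lambda>n. (norm (g n))\<^sup>2)"
  shows "(\<Sum>n. cinner (f n) (g n)) = cnj (\<Sum>n. cinner (g n) (f n))"
proof -
  have "(\<lambda>n. cinner (g n) (f n)) sums (\<Sum>n. cinner (g n) (f n))"
    by (intro summable_sums square_summable_cinner assms)
  then have "(\<lambda>n. cnj (cinner (g n) (f n))) sums cnj (\<Sum>n. cinner (g n) (f n))"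
    by (simp only: sums_cnj)
  then show ?thesis
    unfolding cinner_commute[symmetric] by (rule sums_unique[symmetric])
qed

instantiation ell2 :: (complex_inner) complex_inner
begin
lift_definition scaleC_ell2 :: "complex \<Rightarrow> 'a ell2 \<Rightarrow> 'a ell2" is "\<lambda>c f n. c *\<^sub>C f n"
  by (simp add: square_summable_scaleC)
lift_definition cinner_ell2 :: "'a ell2 \<Rightarrow> 'a ell2 \<Rightarrow> complex" is
  "\<lambda>f g. \<Sum>n. cinner (f n) (g n)" .
instance
proof
  fix x y z :: "'a ell2" and c d :: complex and r :: real
  show "c *\<^sub>C (x + y) = c *\<^sub>C x + c *\<^sub>C y" by transfer (simp add: scaleC_add_right)
  show "(c + d) *\<^sub>C x = c *\<^sub>C x + d *\<^sub>C x" by transfer (simp add: scaleC_add_left)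
  show "c *\<^sub>C d *\<^sub>C x = (c * d) *\<^sub>C x" by transfer (simp add: scaleC_scaleC)
  show "complex_of_real r *\<^sub>C x = r *\<^sub>R x" by transfer (simp add: scaleC_of_real)
  show "cinner x y = cnj (cinner y x)"
    by transfer (rule suminf_cinner_commute)
  show "cinner (x + y) z = cinner x z + cinner y z"
    by transfer (simp add: cinner_add_left suminf_add square_summable_cinner)
  show "cinner (c *\<^sub>C x) y = c * cinner x y"
    by transfer (simp add: cinner_scaleC_left suminf_mult square_summable_cinner)
  show "Re (cinner x y) = inner x y"
    by transfer (simp add: Re_suminf square_summable_cinner Re_cinner)
qed
end

instance ell2 :: (chilbert_space) chilbert_space ..


section \<open>Closed subspaces and operators on them\<close>

definition csubspace :: "'a::complex_inner set \<Rightarrow> bool" where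
  "csubspace M \<longleftrightarrow> 0 \<in> M \<and> (\<forall>x\<in>M. \<forall>y\<in>M. x + y \<in> M) \<and> (\<forall>c. \<forall>x\<in>M. c *\<^sub>C x \<in> M)"

definition closed_csubspace :: "'a::complex_inner set \<Rightarrow> bool" where
  "closed_csubspace M \<longleftrightarrow> csubspace M \<and> closed M"

definition closed_cspan :: "'a::complex_inner set \<Rightarrow> 'a set" where
  "closed_cspan X = closure (csubspace hull X)"

text \<open>
  A Hilbert space \<open>K\<close> is a closed subspace of some type of class \<^class>\<open>chilbert_space\<close>; it may be
  the whole type.  Operators on \<open>K\<close> are extensional functions (they take the value
  \<^const>\<open>undefined\<close> outside \<open>K\<close>), so that equality of operators is equality of functions, and
  \<^term>\<open>compose K A B\<close> is the product of \<open>A\<close> and \<open>B\<close>.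
\<close>

definition bounded_operator :: "'a::complex_inner set \<Rightarrow> ('a \<Rightarrow> 'a) \<Rightarrow> bool" where
  "bounded_operator K A \<longleftrightarrow>
     A \<in> K \<rightarrow>\<^sub>E K \<and>
     (\<forall>x\<in>K. \<forall>y\<in>K. A (x + y) = A x + A y) \<and>
     (\<forall>c. \<forall>x\<in>K. A (c *\<^sub>C x) = c *\<^sub>C A x) \<and>
     (\<exists>B. \<forall>x\<in>K. norm (A x) \<le> B * norm x)"

definition zero_op :: "'a::complex_inner set \<Rightarrow> 'a \<Rightarrow> 'a" where
  "zero_op K = (\<lambda>x\<in>K. 0)"

definition id_op :: "'a::complex_inner set \<Rightarrow> 'a \<Rightarrow> 'a" where
  "id_op K = (\<lambda>x\<in>K. x)"

definition adj :: "'a::complex_inner set \<Rightarrow> ('a \<Rightarrow> 'a) \<Rightarrow> 'a \<Rightarrow> 'a" where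
  "adj K A = (\<lambda>y\<in>K. THE z. z \<in> K \<and> (\<forall>x\<in>K. cinner (A x) y = cinner x z))"

definition op_le :: "'a::complex_inner set \<Rightarrow> ('a \<Rightarrow> 'a) \<Rightarrow> ('a \<Rightarrow> 'a) \<Rightarrow> bool" where
  "op_le K A B \<longleftrightarrow> (\<forall>x\<in>K. cinner (B x - A x) x \<in> \<real>\<^sub>\<ge>\<^sub>0)"

text \<open>
  Strongly convergent sums of operators, taken over the net of finite subsets of the index set.
  All sums below have positive terms, for which this is equivalent to strong convergence of the
  sequence of partial sums in any enumeration.
\<close>

definition strong_has_sum ::
  "'a::complex_inner set \<Rightarrow> ('i \<Rightarrow> 'a \<Rightarrow> 'a) \<Rightarrow> 'i set \<Rightarrow> ('a \<Rightarrow> 'a) \<Rightarrow> bool" where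
  "strong_has_sum K A J B \<longleftrightarrow> (\<forall>x\<in>K. ((\<lambda>j. A j x) has_sum B x) J)"

definition star_mult :: "'a::complex_inner set \<Rightarrow> ('a \<Rightarrow> 'a) \<Rightarrow> 'a \<Rightarrow> 'a" where
  "star_mult K A = compose K (adj K A) A"

definition mult_star :: "'a::complex_inner set \<Rightarrow> ('a \<Rightarrow> 'a) \<Rightarrow> 'a \<Rightarrow> 'a" where
  "mult_star K A = compose K A (adj K A)"

definition reduces :: "'a::complex_inner set \<Rightarrow> ('a \<Rightarrow> 'a) \<Rightarrow> 'a set \<Rightarrow> bool" where
  "reduces K A M \<longleftrightarrow>
     (let N = {y\<in>K. \<forall>x\<in>M. cinner y x = 0} in A ` M \<subseteq> M \<and> A ` N \<subseteq> N)"

definition lin_isometry :: "('a::complex_inner \<Rightarrow> 'b::complex_inner) \<Rightarrow> bool" where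
  "lin_isometry V \<longleftrightarrow>
     (\<forall>x y. V (x + y) = V x + V y) \<and> (\<forall>c x. V (c *\<^sub>C x) = c *\<^sub>C V x) \<and>
     (\<forall>x y. cinner (V x) (V y) = cinner x y)"


section \<open>Tuples of operators and dilations\<close>

text \<open>
  An \<open>n\<close>-tuple with \<open>n \<in> {1, 2, \<dots>, \<infinity>}\<close> is a function on \<^typ>\<open>nat\<close> of which only the values at
  the indices in \<open>idx n\<close> matter; indices start at 0.
\<close>

definition idx :: "enat \<Rightarrow> nat set" where
  "idx n = {i. enat i < n}"

definition nonzero_tuple :: "'a::complex_inner set \<Rightarrow> enat \<Rightarrow> (nat \<Rightarrow> 'a \<Rightarrow> 'a) \<Rightarrow> bool" where
  "nonzero_tuple K n S \<longleftrightarrow> (\<forall>i\<in>idx n. bounded_operator K (S i) \<and> S i \<noteq> zero_op K)"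

definition row_contraction :: "'a::complex_inner set \<Rightarrow> enat \<Rightarrow> (nat \<Rightarrow> 'a \<Rightarrow> 'a) \<Rightarrow> bool" where
  "row_contraction K n S \<longleftrightarrow>
     (\<exists>B. strong_has_sum K (\<lambda>i. mult_star K (S i)) (idx n) B \<and> op_le K B (id_op K))"

definition coisometric :: "'a::complex_inner set \<Rightarrow> enat \<Rightarrow> (nat \<Rightarrow> 'a \<Rightarrow> 'a) \<Rightarrow> bool" where
  "coisometric K n S \<longleftrightarrow> strong_has_sum K (\<lambda>i. mult_star K (S i)) (idx n) (id_op K)"

definition dagger :: "'a::complex_inner set \<Rightarrow> enat \<Rightarrow> (nat \<Rightarrow> 'a \<Rightarrow> 'a) \<Rightarrow> bool" where
  "dagger K n S \<longleftrightarrow>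
     nonzero_tuple K n S \<and>
     (\<forall>i\<in>idx n. compose K (star_mult K (S i)) (star_mult K (S i)) = star_mult K (S i)) \<and>
     row_contraction K n S \<and>
     (\<forall>i\<in>idx n. \<forall>j\<in>idx n.
        compose K (star_mult K (S i)) (star_mult K (S j)) = zero_op K \<or>
        star_mult K (S i) = star_mult K (S j)) \<and>
     (\<forall>i\<in>idx n. \<exists>j\<in>idx n. op_le K (mult_star K (S i)) (star_mult K (S j))) \<and>
     strong_has_sum K (\<lambda>Q. Q) ((\<lambda>i. star_mult K (S i)) ` idx n) (id_op K)"

definition fully_coisometric :: "'a::complex_inner set \<Rightarrow> enat \<Rightarrow> (nat \<Rightarrow> 'a \<Rightarrow> 'a) \<Rightarrow> bool" where
  "fully_coisometric K n S \<longleftrightarrow> dagger K n S \<and> coisometric K n S"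

text \<open>
  The inclusion of the space \<open>'h\<close> of \<open>T\<close> in the dilation space \<open>K\<close> is given by a linear
  isometry \<open>V\<close>, with image \<open>H\<close>.  A product \<open>S\<^bsub>i\<^sub>1\<^esub> \<dots> S\<^bsub>i\<^sub>k\<^esub>\<close> is \<^term>\<open>foldr S w\<close> for the
  list \<open>w = [i\<^sub>1, \<dots>, i\<^sub>k]\<close>.
\<close>

definition minimal_dilation ::
  "'k::complex_inner set \<Rightarrow> ('h::complex_inner \<Rightarrow> 'k) \<Rightarrow> enat \<Rightarrow>
   (nat \<Rightarrow> 'k \<Rightarrow> 'k) \<Rightarrow> (nat \<Rightarrow> 'h \<Rightarrow> 'h) \<Rightarrow> bool" where
  "minimal_dilation K V n S T \<longleftrightarrow>
     (let H = range V in
      closed_csubspace K \<and> lin_isometry V \<and> H \<subseteq> K \<and>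
      dagger K n S \<and>
      (\<forall>i\<in>idx n. reduces K (star_mult K (S i)) H \<and>
         adj K (S i) ` H \<subseteq> H \<and>
         (\<forall>x. adj K (S i) (V x) = V (adj UNIV (T i) x))) \<and>
      K = closed_cspan (H \<union> (\<Union>w\<in>lists (idx n) - {[]}. foldr S w ` H)))"

text \<open>
  To speak about every minimal dilation inside a formula, the dilation spaces have to be taken
  from a fixed type.  We use closed subspaces of \<open>('k, 'h) ambient\<close>, where \<open>'k\<close> is an arbitrary
  type variable of class \<^class>\<open>chilbert_space\<close>.  The factor \<open>'k\<close> makes any given Hilbert space
  available as a dilation space, namely as \<open>UNIV \<times> {0}\<close>.  The factor \<^typ>\<open>'h ell2\<close> ensures that
  the ambient space is never too small: a minimal dilation space is the closed span of the
  countably many subspaces \<open>S\<^bsub>i\<^sub>1\<^esub> \<dots> S\<^bsub>i\<^sub>k\<^esub> H\<close>, so it is isometrically isomorphic to a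
  closed subspace of \<open>'h ell2\<close>.
\<close>

type_synonym ('k, 'h) ambient = "'k \<times> 'h ell2"

end

theory Submission
  imports Defs
begin

text \<open>
  Whether a minimal dilation \<open>S\<close> on \<open>K\<close> is fully coisometric does not depend on the dilation.  Let
  \<open>B\<close> be the sum of the operators \<open>S i (S i)*\<close>, so \<open>0 \<le> B \<le> I\<close>; then \<open>B x = x\<close> iff
  \<open>\<Sum>i. \<parallel>(S i)* x\<parallel>\<^sup>2 = \<parallel>x\<parallel>\<^sup>2\<close>.  The adjoints \<open>(S i)*\<close> extend \<open>(T i)*\<close>, hence \<open>B\<close> fixes the space of
  \<open>T\<close> pointwise iff \<open>T\<close> is coisometric.  Furthermore, \<open>B\<close> always fixes the range of each \<open>S i\<close>,
  because \<open>S i\<close> is a partial isometry.  By minimality, the space of \<open>T\<close> and the ranges of the \<open>S i\<close>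
  span \<open>K\<close>, so \<open>B = I\<close> iff \<open>T\<close> is coisometric.  This is \<open>minimal_dilation_coisometric_iff\<close>.

  The direction from dilations to \<open>T\<close> moreover needs one minimal dilation to exist in the ambient
  space (\<open>minimal_dilation_exists\<close>).  A dilation by isometries with orthogonal ranges satisfies all
  the relations, since every \<open>(S i)* (S i)\<close> is then the identity.  It is built on square-summable
  sequences over the space of \<open>T\<close> from a defect operator \<open>D\<close> with \<open>D* D = I - R* R\<close>, where \<open>R\<close> is
  the row operator of \<open>T\<close>.  Instead of a square root, \<open>D\<close> is the sequence of the iterates of
  \<open>b \<mapsto> b - b\<^sup>2\<close> starting from \<open>I - R* R\<close>, whose squares sum to their initial value
  (\<open>positive_contraction_factorization\<close>).
\<close>

section \<open>Real Hilbert space geometry\<close>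

lemma csubspace_scaleR: "csubspace K \<Longrightarrow> x \<in> K \<Longrightarrow> r *\<^sub>R x \<in> K"
  by (metis csubspace_def scaleC_of_real)

lemma csubspace_add: "csubspace K \<Longrightarrow> x \<in> K \<Longrightarrow> y \<in> K \<Longrightarrow> x + y \<in> K"
  by (simp add: csubspace_def)

lemma csubspace_scaleC: "csubspace K \<Longrightarrow> x \<in> K \<Longrightarrow> c *\<^sub>C x \<in> K"
  by (simp add: csubspace_def)

lemma csubspace_0: "csubspace K \<Longrightarrow> 0 \<in> K"
  by (simp add: csubspace_def)

lemma csubspace_diff: "csubspace K \<Longrightarrow> x \<in> K \<Longrightarrow> y \<in> K \<Longrightarrow> x - y \<in> K"
  using csubspace_add[of K x "- y"] csubspace_scaleR[of K y "- 1"] by simp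

lemma csubspace_imp_subspace: "csubspace K \<Longrightarrow> subspace K"
  by (simp add: subspace_def csubspace_0 csubspace_add csubspace_scaleR)

lemma closed_csubspace_UNIV: "closed_csubspace UNIV"
  by (simp add: closed_csubspace_def csubspace_def)

text \<open>
  The inequality \<open>B\<^sup>2 \<le> B\<close> for \<open>0 \<le> B \<le> I\<close>, by testing positivity of \<open>B\<close> on \<open>x - B x\<close>.  It
  shows that the form of \<open>B\<close> detects fixed points, and it keeps the iteration \<open>B \<mapsto> B - B\<^sup>2\<close>
  inside the positive contractions.
\<close>

lemma positive_contraction_norm_sq_le:
  fixes B :: "'a::real_inner \<Rightarrow> 'a"
  assumes K: "\<And>x y. x \<in> K \<Longrightarrow> y \<in> K \<Longrightarrow> x - y \<in> K" "\<And>x. x \<in> K \<Longrightarrow> B x \<in> K"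
    and diff: "\<And>x y. x \<in> K \<Longrightarrow> y \<in> K \<Longrightarrow> B (x - y) = B x - B y"
    and symm: "\<And>x y. x \<in> K \<Longrightarrow> y \<in> K \<Longrightarrow> inner (B x) y = inner x (B y)"
    and pos: "\<And>x. x \<in> K \<Longrightarrow> 0 \<le> inner (B x) x"
    and contr: "\<And>x. x \<in> K \<Longrightarrow> inner (B x) x \<le> inner x x"
    and x: "x \<in> K"
  shows "(norm (B x))\<^sup>2 \<le> inner (B x) x"
proof -
  have Bx: "B x \<in> K" using K x by blast
  have "0 \<le> inner (B (x - B x)) (x - B x)"
    using pos K x Bx by blast
  also have "\<dots> = inner (B x) x - 2 * inner (B x) (B x) + inner (B (B x)) (B x)"
    using symm[of "B x" x] by (simp add: diff x Bx inner_diff inner_commute)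
  also have "\<dots> \<le> inner (B x) x - inner (B x) (B x)"
    using contr[OF Bx] by simp
  finally show ?thesis by (simp add: power2_norm_eq_inner)
qed

text \<open>
  Equality in \<open>\<langle>B x, x\<rangle> \<le> \<langle>x, x\<rangle>\<close> forces \<open>B x = x\<close>: expand the square of \<open>B x - x\<close>.
\<close>

lemma positive_contraction_fixed:
  fixes B :: "'a::real_inner \<Rightarrow> 'a"
  assumes "(norm (B x))\<^sup>2 \<le> inner (B x) x" "inner (B x) x = inner x x"
  shows "B x = x"
proof -
  have "(norm (B x - x))\<^sup>2 = (norm (B x))\<^sup>2 - 2 * inner (B x) x + inner x x"
    by (simp add: power2_norm_eq_inner inner_diff inner_commute)
  then have "(norm (B x - x))\<^sup>2 \<le> 0" using assms by simp
  then show ?thesis by simp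
qed

text \<open>
  By Pythagoras, a finite partial sum beyond \<open>F0\<close> has squared norm equal to the corresponding
  partial sum of the squared norms, so the net of partial sums is Cauchy.
\<close>

lemma orthogonal_square_summable_imp_summable:
  fixes v :: "'i \<Rightarrow> 'a::{real_inner, complete_space}"
  assumes orth: "\<And>i j. i \<in> J \<Longrightarrow> j \<in> J \<Longrightarrow> i \<noteq> j \<Longrightarrow> inner (v i) (v j) = 0"
    and bound: "\<And>F. finite F \<Longrightarrow> F \<subseteq> J \<Longrightarrow> (\<Sum>i\<in>F. (norm (v i))\<^sup>2) \<le> C"
  shows "v summable_on J"
proof -
  have "(\<lambda>i. (norm (v i))\<^sup>2) summable_on J"
    by (rule nonneg_bounded_partial_sums_imp_summable_on[where C = C])
       (auto intro!: eventually_finite_subsets_at_top_weakI bound)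
  then obtain s where s: "((\<lambda>i. (norm (v i))\<^sup>2) has_sum s) J"
    unfolding summable_on_def by blast
  have "\<exists>P. eventually P (finite_subsets_at_top J) \<and>
          (\<forall>F F'. P F \<and> P F' \<longrightarrow> dist (sum v F) (sum v F') < e)" if "e > 0" for e
  proof -
    have "(e/4)\<^sup>2 > 0" using \<open>e > 0\<close> by simp
    from has_sum_finite_approximation[OF s this] obtain F0 where
      F0: "finite F0" "F0 \<subseteq> J" "dist (\<Sum>i\<in>F0. (norm (v i))\<^sup>2) s \<le> (e/4)\<^sup>2"
      by blast
    define P where "P F \<longleftrightarrow> finite F \<and> F0 \<subseteq> F \<and> F \<subseteq> J" for F
    have close: "dist (sum v F) (sum v F0) \<le> e/4" if "P F" for F
    proof -
      have F: "finite F" "F0 \<subseteq> F" "F \<subseteq> J" using that by (auto simp: P_def)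
      have "(dist (sum v F) (sum v F0))\<^sup>2 = (norm (sum v (F - F0)))\<^sup>2"
        using F by (simp add: dist_norm sum_diff)
      also have "\<dots> = (\<Sum>i\<in>F - F0. (norm (v i))\<^sup>2)"
        using F by (intro norm_sum_Pythagorean) (auto simp: pairwise_def orthogonal_def intro!: orth)
      also have "\<dots> = (\<Sum>i\<in>F. (norm (v i))\<^sup>2) - (\<Sum>i\<in>F0. (norm (v i))\<^sup>2)"
        using F by (simp add: sum_diff)
      also have "\<dots> \<le> s - (\<Sum>i\<in>F0. (norm (v i))\<^sup>2)"
        using finite_sum_le_has_sum[OF s F(1) F(3)] by simp
      also have "\<dots> \<le> (e/4)\<^sup>2" using F0(3) by (simp add: dist_real_def)
      finally show ?thesis using \<open>e > 0\<close> by (simp add: power2_le_iff_abs_le)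
    qed
    have "eventually P (finite_subsets_at_top J)"
      unfolding P_def eventually_finite_subsets_at_top using F0 by blast
    moreover have "dist (sum v F) (sum v F') < e" if "P F" "P F'" for F F'
      using close[OF that(1)] close[OF that(2)] \<open>e > 0\<close>
        dist_triangle2[of "sum v F" "sum v F'" "sum v F0"] by linarith
    ultimately show ?thesis by blast
  qed
  then have "cauchy_filter (filtermap (sum v) (finite_subsets_at_top J))"
    by (simp add: cauchy_filter_metric_filtermap)
  moreover have "complete (UNIV :: 'a set)"
    by (meson Cauchy_convergent UNIV_I complete_def convergent_def)
  ultimately obtain l where "(sum v \<longlongrightarrow> l) (finite_subsets_at_top J)"
    using complete_uniform[where S = UNIV] by (force simp add: filterlim_def)
  then show ?thesis using summable_on_def has_sum_def by blast
qed

text \<open>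
  The representing vector minimises \<open>q x = \<parallel>x\<parallel>\<^sup>2 - 2 f x\<close> on \<open>K\<close>: if \<open>f = \<langle>_, z\<rangle>\<close>, then
  \<open>q x = \<parallel>x - z\<parallel>\<^sup>2 - \<parallel>z\<parallel>\<^sup>2\<close>.  The parallelogram law makes every minimising sequence Cauchy, and the
  first-order condition at the minimum is the representation of \<open>f\<close>.
\<close>

lemma Riesz_representation:
  fixes f :: "'a::{real_inner, complete_space} \<Rightarrow> real"
  assumes K: "subspace K" "closed K"
    and add: "\<And>x y. x \<in> K \<Longrightarrow> y \<in> K \<Longrightarrow> f (x + y) = f x + f y"
    and scale: "\<And>r x. x \<in> K \<Longrightarrow> f (r *\<^sub>R x) = r * f x"
    and bound: "\<And>x. x \<in> K \<Longrightarrow> \<bar>f x\<bar> \<le> C * norm x"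
  shows "\<exists>z\<in>K. \<forall>x\<in>K. f x = inner x z"
proof -
  define q where "q x = (norm x)\<^sup>2 - 2 * f x" for x
  have K_add: "x \<in> K \<Longrightarrow> y \<in> K \<Longrightarrow> x + y \<in> K" and K_scale: "x \<in> K \<Longrightarrow> r *\<^sub>R x \<in> K" for x y r
    using K by (auto simp: subspace_def)
  have K_diff: "x \<in> K \<Longrightarrow> y \<in> K \<Longrightarrow> x - y \<in> K" for x y
    using K by (simp add: subspace_diff)
  have f_diff: "f (x - y) = f x - f y" if "x \<in> K" "y \<in> K" for x y
    using add[of x "(- 1) *\<^sub>R y"] scale[of y "- 1"] K_scale[of y "- 1"] that by simp
  have lower: "- C\<^sup>2 \<le> q x" if "x \<in> K" for x
  proof -
    have "f x \<le> C * norm x" using bound[OF that] by simp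
    moreover have "0 \<le> (norm x - C)\<^sup>2" by simp
    ultimately show ?thesis unfolding q_def power2_diff by (simp add: mult.commute)
  qed
  define m where "m = Inf (q ` K)"
  have bdd: "bdd_below (q ` K)" using lower by (auto intro!: bdd_belowI)
  have ne: "q ` K \<noteq> {}" using K by (auto simp: subspace_def)
  have m_le: "m \<le> q x" if "x \<in> K" for x
    unfolding m_def using that bdd by (intro cInf_lower) auto
  have "\<exists>x\<in>K. q x < m + 1 / Suc n" for n
    using cInf_lessD[OF ne, of "m + 1 / Suc n"] unfolding m_def[symmetric] by auto
  then obtain X where X: "\<And>n. X n \<in> K" "\<And>n. q (X n) < m + 1 / Suc n"
    by metis
  have para: "(norm (x - y))\<^sup>2 \<le> 2 * (q x - m) + 2 * (q y - m)" if "x \<in> K" "y \<in> K" for x y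
  proof -
    have "m \<le> q ((1/2) *\<^sub>R (x + y))" using that by (intro m_le K_scale K_add)
    also have "\<dots> = (norm (x + y))\<^sup>2 / 4 - f x - f y"
    proof -
      have "f ((1/2) *\<^sub>R (x + y)) = (f x + f y) / 2"
        using that by (simp add: scale add K_add del: scaleR_add_right)
      then show ?thesis by (simp add: q_def power_divide)
    qed
    finally have "4 * m \<le> (norm (x + y))\<^sup>2 - 4 * f x - 4 * f y" by simp
    moreover have "(norm (x + y))\<^sup>2 + (norm (x - y))\<^sup>2 = 2 * (norm x)\<^sup>2 + 2 * (norm y)\<^sup>2"
      by (simp add: power2_norm_eq_inner inner_simps inner_commute)
    ultimately show ?thesis by (simp add: q_def)
  qed
  have "Cauchy X"
  proof (rule metric_CauchyI)
    fix e :: real assume "e > 0"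
    then have "e\<^sup>2 / 4 > 0" by simp
    then obtain N where N: "1 / Suc N < e\<^sup>2 / 4"
      using reals_Archimedean by (metis inverse_eq_divide)
    have small: "q (X n) - m < e\<^sup>2 / 4" if "n \<ge> N" for n
    proof -
      have "1 / Suc n \<le> 1 / Suc N" using that by (simp add: frac_le)
      then show ?thesis using X(2)[of n] N by linarith
    qed
    have "dist (X i) (X j) < e" if "i \<ge> N" "j \<ge> N" for i j
    proof -
      have "(norm (X i - X j))\<^sup>2 < e\<^sup>2"
        using para[OF X(1) X(1), of i j] small[OF that(1)] small[OF that(2)] by simp
      then show ?thesis using \<open>e > 0\<close> by (simp add: dist_norm power2_less_imp_less)
    qed
    then show "\<exists>N. \<forall>i\<ge>N. \<forall>j\<ge>N. dist (X i) (X j) < e" by blast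
  qed
  then obtain z where z: "X \<longlonglongrightarrow> z" using Cauchy_convergent unfolding convergent_def by blast
  then have zK: "z \<in> K" using K(2) X(1) closed_sequentially by blast
  have "(\<lambda>n. f (X n - z)) \<longlonglongrightarrow> 0"
  proof (rule Lim_null_comparison)
    show "\<forall>\<^sub>F n in sequentially. norm (f (X n - z)) \<le> C * norm (X n - z)"
      using bound[OF K_diff[OF X(1) zK]] by simp
    show "(\<lambda>n. C * norm (X n - z)) \<longlonglongrightarrow> 0"
      using z by (intro tendsto_mult_right_zero tendsto_norm_zero) (simp add: LIM_zero)
  qed
  then have "(\<lambda>n. f (X n)) \<longlonglongrightarrow> f z"
    using f_diff[OF X(1) zK] by (simp add: LIM_zero_iff)
  then have "(\<lambda>n. q (X n)) \<longlonglongrightarrow> q z"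
    unfolding q_def by (intro tendsto_intros z)
  moreover have "(\<lambda>n. m + 1 / Suc n) \<longlonglongrightarrow> m"
    using LIMSEQ_inverse_real_of_nat_add[of m] by (simp add: inverse_eq_divide)
  ultimately have qz: "q z \<le> m"
    using X(2) by (intro LIMSEQ_le[of "\<lambda>n. q (X n)" _ "\<lambda>n. m + 1 / Suc n"]) (auto intro: less_imp_le)
  have "f x = inner x z" if x: "x \<in> K" for x
  proof -
    define d where "d = f x - inner x z"
    have perturb: "0 \<le> t\<^sup>2 * (norm x)\<^sup>2 - 2 * t * d" for t
    proof -
      have "q z \<le> q (z + t *\<^sub>R x)"
        using qz m_le[OF K_add[OF zK K_scale[OF x]]] by (rule order_trans)
      also have "\<dots> = q z + (t\<^sup>2 * (norm x)\<^sup>2 - 2 * t * d)"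
        using x zK unfolding q_def d_def power2_norm_eq_inner
        by (simp add: add scale K_scale inner_simps inner_commute algebra_simps power2_eq_square)
      finally show ?thesis by simp
    qed
    \<comment> \<open>The minimiser of the bound would be \<open>d / \<parallel>x\<parallel>\<^sup>2\<close>; the summand 1 covers \<open>x = 0\<close>.\<close>
    define t where "t = d / (1 + (norm x)\<^sup>2)"
    have pos: "1 + (norm x)\<^sup>2 > 0" by (simp add: add_pos_nonneg)
    then have "d = t * (1 + (norm x)\<^sup>2)" by (simp add: t_def)
    then have "t\<^sup>2 * (norm x)\<^sup>2 - 2 * t * d = - (t\<^sup>2 * ((norm x)\<^sup>2 + 2))"
      by (simp add: power2_eq_square algebra_simps)
    then have "t\<^sup>2 * ((norm x)\<^sup>2 + 2) \<le> 0" using perturb[of t] by simp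
    moreover have "(norm x)\<^sup>2 + 2 > 0" by (simp add: add_nonneg_pos)
    ultimately have "t = 0" by (simp add: mult_le_0_iff)
    then have "d = 0" using pos by (simp add: t_def)
    then show ?thesis by (simp add: d_def)
  qed
  then show ?thesis using zK by blast
qed

section \<open>Adjoints\<close>

lemma scaleC_minus_one: "(- 1) *\<^sub>C x = - x"
  using scaleC_of_real[of "- 1" x] by simp

lemma scaleC_zero: "c *\<^sub>C 0 = 0"
  using norm_scaleC[of c 0] by simp

lemma cinner_add_right: "cinner x (y + z) = cinner x y + cinner x z"
  by (metis cinner_add_left cinner_commute complex_cnj_add)

lemma cinner_scaleC_right: "cinner x (c *\<^sub>C y) = cnj c * cinner x y"
  by (metis cinner_scaleC_left cinner_commute complex_cnj_mult)

lemma cinner_minus_left: "cinner (- x) y = - cinner x y"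
  using cinner_scaleC_left[of "- 1" x y] by (simp add: scaleC_minus_one)

lemma cinner_diff_left: "cinner (x - y) z = cinner x z - cinner y z"
  using cinner_add_left[of x "- y" z] by (simp add: cinner_minus_left)

lemma cinner_diff_right: "cinner z (x - y) = cinner z x - cinner z y"
  by (metis cinner_diff_left cinner_commute complex_cnj_diff)

text \<open>
  The real inner product determines the complex one, because \<open>Im \<langle>x, y\<rangle> = Re \<langle>- \<i> x, y\<rangle>\<close>.  Identities
  between complex inner products can thus be checked with the real form alone.
\<close>

lemma cinner_eqI:
  assumes "\<And>c. inner (c *\<^sub>C x) y = inner (c *\<^sub>C x') y'"
  shows "cinner x y = cinner x' y'"
proof (rule complex_eqI)
  have "1 *\<^sub>C v = v" for v :: "'c::complex_inner" using scaleC_of_real[of 1 v] by simp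
  then show "Re (cinner x y) = Re (cinner x' y')"
    using assms[of 1] by (metis Re_cinner scaleC_of_real scaleR_one of_real_1)
  show "Im (cinner x y) = Im (cinner x' y')"
    using assms[of "- \<i>"] by (simp add: Im_cinner)
qed

lemma cinner_right_cancel:
  assumes "csubspace K" "z \<in> K" "z' \<in> K" "\<And>x. x \<in> K \<Longrightarrow> cinner x z = cinner x z'"
  shows "z = z'"
proof -
  have "cinner (z - z') (z - z') = 0"
    using assms csubspace_diff[OF assms(1-3)] by (simp add: cinner_diff_right)
  then show ?thesis by (simp add: cinner_self)
qed

lemma bounded_operatorD:
  assumes "bounded_operator K A"
  shows "x \<in> K \<Longrightarrow> A x \<in> K"
    and "x \<in> K \<Longrightarrow> y \<in> K \<Longrightarrow> A (x + y) = A x + A y"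
    and "x \<in> K \<Longrightarrow> A (c *\<^sub>C x) = c *\<^sub>C A x"
    and "A \<in> extensional K"
  using assms by (auto simp: bounded_operator_def PiE_iff)

text \<open>
  The description in the definition of the adjoint is only meaningful once such a vector exists;
  completeness of \<open>K\<close> enters here.
\<close>

lemma adj_exists:
  fixes K :: "'a::chilbert_space set"
  assumes K: "closed_csubspace K" and A: "bounded_operator K A" and y: "y \<in> K"
  shows "\<exists>z\<in>K. \<forall>x\<in>K. cinner (A x) y = cinner x z"
proof -
  note A' = bounded_operatorD[OF A]
  have cs: "csubspace K" and cl: "closed K" using K by (auto simp: closed_csubspace_def)
  obtain C where C: "\<And>x. x \<in> K \<Longrightarrow> norm (A x) \<le> C * norm x"
    using A unfolding bounded_operator_def by blast
  have "\<exists>z\<in>K. \<forall>x\<in>K. inner (A x) y = inner x z"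
  proof (rule Riesz_representation[where C = "C * norm y"])
    show "inner (A (r *\<^sub>R x)) y = r * inner (A x) y" if "x \<in> K" for r x
      using A'(3)[OF that, of "complex_of_real r"] by (simp add: scaleC_of_real)
    show "\<bar>inner (A x) y\<bar> \<le> C * norm y * norm x" if "x \<in> K" for x
    proof -
      have "\<bar>inner (A x) y\<bar> \<le> norm (A x) * norm y" by (rule Cauchy_Schwarz_ineq2)
      also have "\<dots> \<le> (C * norm x) * norm y" using C[OF that] by (intro mult_right_mono) auto
      finally show ?thesis by (simp add: ac_simps)
    qed
  qed (use cs cl A' in \<open>auto simp: csubspace_imp_subspace inner_add_left\<close>)
  then obtain z where z: "z \<in> K" "\<And>x. x \<in> K \<Longrightarrow> inner (A x) y = inner x z" by blast
  have "cinner (A x) y = cinner x z" if "x \<in> K" for x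
    using z(2)[OF csubspace_scaleC[OF cs that]] A'(3)[OF that] by (intro cinner_eqI) simp
  then show ?thesis using z(1) by blast
qed

lemma adj_eqI:
  assumes "csubspace K" "y \<in> K" "z \<in> K" "\<And>x. x \<in> K \<Longrightarrow> cinner (A x) y = cinner x z"
  shows "adj K A y = z"
proof -
  have "(THE z. z \<in> K \<and> (\<forall>x\<in>K. cinner (A x) y = cinner x z)) = z"
  proof (rule the_equality)
    fix z' assume "z' \<in> K \<and> (\<forall>x\<in>K. cinner (A x) y = cinner x z')"
    then show "z' = z" using assms by (intro cinner_right_cancel[of K]) auto
  qed (use assms in auto)
  then show ?thesis using assms by (simp add: adj_def)
qed

lemma adj:
  fixes K :: "'a::chilbert_space set"
  assumes "closed_csubspace K" "bounded_operator K A" "y \<in> K"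
  shows adj_in: "adj K A y \<in> K"
    and adj_cinner: "x \<in> K \<Longrightarrow> cinner (A x) y = cinner x (adj K A y)"
proof -
  obtain z where z: "z \<in> K" "\<forall>x\<in>K. cinner (A x) y = cinner x z"
    using adj_exists[OF assms] by blast
  moreover from this have "adj K A y = z"
    using assms by (intro adj_eqI) (auto simp: closed_csubspace_def)
  ultimately show "adj K A y \<in> K" "x \<in> K \<Longrightarrow> cinner (A x) y = cinner x (adj K A y)" by auto
qed

lemma adj_inner:
  fixes K :: "'a::chilbert_space set"
  assumes "closed_csubspace K" "bounded_operator K A" "x \<in> K" "y \<in> K"
  shows "inner (A x) y = inner x (adj K A y)"
  using adj_cinner[OF assms(1,2,4,3)] by (metis Re_cinner)

lemma adj_add:
  fixes K :: "'a::chilbert_space set"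
  assumes "closed_csubspace K" "bounded_operator K A" "x \<in> K" "y \<in> K"
  shows "adj K A (x + y) = adj K A x + adj K A y"
  using assms unfolding closed_csubspace_def
  by (intro adj_eqI) (auto simp: csubspace_add adj_in[OF assms(1,2)] cinner_add_right
      adj_cinner[OF assms(1,2)])

lemma adj_scaleC:
  fixes K :: "'a::chilbert_space set"
  assumes "closed_csubspace K" "bounded_operator K A" "x \<in> K"
  shows "adj K A (c *\<^sub>C x) = c *\<^sub>C adj K A x"
  using assms unfolding closed_csubspace_def
  by (intro adj_eqI) (auto simp: csubspace_scaleC adj_in[OF assms(1,2)] cinner_scaleC_right
      adj_cinner[OF assms(1,2)])

lemma cinner_mult_star:
  fixes K :: "'a::chilbert_space set"
  assumes "closed_csubspace K" "bounded_operator K A" "x \<in> K" "y \<in> K"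
  shows "cinner (mult_star K A x) y = cinner (adj K A x) (adj K A y)"
  using adj_cinner[OF assms(1,2,4) adj_in[OF assms(1,2,3)]] assms(3)
  by (simp add: mult_star_def compose_def)

lemma cinner_star_mult:
  fixes K :: "'a::chilbert_space set"
  assumes "closed_csubspace K" "bounded_operator K A" "x \<in> K" "y \<in> K"
  shows "cinner x (star_mult K A y) = cinner (A x) (A y)"
  using adj_cinner[OF assms(1,2) bounded_operatorD(1)[OF assms(2,4)] assms(3)] assms(4)
  by (simp add: star_mult_def compose_def)

section \<open>Row contractions\<close>

lemma has_sum_eq_rhs:
  "(f has_sum s) A \<Longrightarrow> (\<And>x. x \<in> A \<Longrightarrow> f x = g x) \<Longrightarrow> (g has_sum s) A"
  using has_sum_cong by blast

context
  fixes K :: "'a::chilbert_space set" and J :: "'i set" and S :: "'i \<Rightarrow> 'a \<Rightarrow> 'a" and B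
  assumes K: "closed_csubspace K"
    and S: "\<And>i. i \<in> J \<Longrightarrow> bounded_operator K (S i)"
    and B: "strong_has_sum K (\<lambda>i. mult_star K (S i)) J B"
begin

text \<open>
  Throughout, \<open>B\<close> is the strong sum of the operators \<open>S i (S i)*\<close>.  Its form is
  \<open>\<langle>B x, y\<rangle> = \<Sum>i. \<langle>(S i)* x, (S i)* y\<rangle>\<close>, from which all algebraic properties of \<open>B\<close> follow.
\<close>

lemma strong_sum_inner:
  assumes "x \<in> K" "y \<in> K"
  shows "((\<lambda>i. inner (adj K (S i) x) (adj K (S i) y)) has_sum inner (B x) y) J"
proof -
  have "((\<lambda>i. inner (mult_star K (S i) x) y) has_sum inner (B x) y) J"
    using B assms unfolding strong_has_sum_def
    by (intro has_sum_bounded_linear[OF bounded_linear_inner_left]) blast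
  moreover have "inner (mult_star K (S i) x) y = inner (adj K (S i) x) (adj K (S i) y)"
    if "i \<in> J" for i
    using cinner_mult_star[OF K S[OF that] assms] by (metis Re_cinner)
  ultimately show ?thesis by (rule has_sum_eq_rhs)
qed

lemma strong_sum_in:
  assumes "x \<in> K"
  shows "B x \<in> K"
proof -
  have sub: "subspace K" and "closed K"
    using K by (auto simp: closed_csubspace_def csubspace_imp_subspace)
  have "(sum (\<lambda>i. mult_star K (S i) x) \<longlongrightarrow> B x) (finite_subsets_at_top J)"
    using B assms by (simp add: strong_has_sum_def has_sum_def)
  moreover have "mult_star K (S i) x \<in> K" if "i \<in> J" for i
    using assms by (simp add: mult_star_def compose_def adj_in[OF K S[OF that]]
        bounded_operatorD(1)[OF S[OF that]])
  then have "\<forall>\<^sub>F F in finite_subsets_at_top J. (\<Sum>i\<in>F. mult_star K (S i) x) \<in> K"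
    by (intro eventually_finite_subsets_at_top_weakI subspace_sum[OF sub]) auto
  ultimately show ?thesis
    using Lim_in_closed_set[OF \<open>closed K\<close>] finite_subsets_at_top_neq_bot by blast
qed

lemma strong_sum_diff:
  assumes "x \<in> K" "y \<in> K"
  shows "B (x - y) = B x - B y"
proof -
  have cs: "csubspace K" using K by (simp add: closed_csubspace_def)
  have d: "x - y \<in> K" using csubspace_diff[OF cs assms] .
  have "inner (B (x - y)) z = inner (B x - B y) z" if z: "z \<in> K" for z
  proof -
    have "inner (adj K (S i) (x - y)) w = inner (adj K (S i) x) w + - 1 * inner (adj K (S i) y) w"
      if "i \<in> J" for i w
      using adj_add[OF K S[OF that] d assms(2)] by (simp add: inner_add_left)
    then have "((\<lambda>i. inner (adj K (S i) x) (adj K (S i) z) + - 1 * inner (adj K (S i) y) (adj K (S i) z))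
        has_sum inner (B (x - y)) z) J"
      by (rule has_sum_eq_rhs[OF strong_sum_inner[OF d z]])
    moreover have "((\<lambda>i. inner (adj K (S i) x) (adj K (S i) z) + - 1 * inner (adj K (S i) y) (adj K (S i) z))
        has_sum inner (B x) z + - 1 * inner (B y) z) J"
      by (intro has_sum_add has_sum_cmult_right strong_sum_inner assms z)
    ultimately have "inner (B (x - y)) z = inner (B x) z + - 1 * inner (B y) z"
      by (rule has_sum_unique)
    then show ?thesis by (simp add: inner_diff_left)
  qed
  from this[of "B (x - y) - (B x - B y)"]
  have "inner (B (x - y) - (B x - B y)) (B (x - y) - (B x - B y)) = 0"
    using assms d by (simp add: inner_diff_left csubspace_diff[OF cs] strong_sum_in)
  then show ?thesis by simp
qed

lemma strong_sum_norm:
  assumes "x \<in> K"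
  shows "((\<lambda>i. (norm (adj K (S i) x))\<^sup>2) has_sum inner (B x) x) J"
  using strong_sum_inner[OF assms assms] by (simp add: power2_norm_eq_inner)

lemma op_le_id_iff:
  "op_le K B (id_op K) \<longleftrightarrow> (\<forall>x\<in>K. inner (B x) x \<le> inner x x)"
proof -
  have "cinner (id_op K x - B x) x \<in> \<real>\<^sub>\<ge>\<^sub>0 \<longleftrightarrow> inner (B x) x \<le> inner x x" if x: "x \<in> K" for x
  proof -
    have ix: "\<i> *\<^sub>C x \<in> K" using K x by (simp add: closed_csubspace_def csubspace_scaleC)
    have im: "Im (cinner u v) = inner u (\<i> *\<^sub>C v)" for u v :: 'a
      by (simp add: cinner_scaleC_right flip: Re_cinner)
    \<comment> \<open>The form of \<open>B\<close> is real on the diagonal, since each of its summands is a squared norm.\<close>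
    have "inner (adj K (S i) x) (adj K (S i) (\<i> *\<^sub>C x)) = 0" if "i \<in> J" for i
      using adj_scaleC[OF K S[OF that] x]
      by (simp add: cinner_self flip: im)
    then have "((\<lambda>i. 0) has_sum inner (B x) (\<i> *\<^sub>C x)) J"
      by (rule has_sum_eq_rhs[OF strong_sum_inner[OF x ix]])
    then have "Im (cinner (B x) x) = 0"
      using has_sum_0 has_sum_unique by (metis im)
    then have "Im (cinner (x - B x) x) = 0"
      by (simp add: cinner_diff_left cinner_self)
    then show ?thesis
      using x by (auto simp: id_op_def complex_nonneg_Reals_iff Re_cinner inner_diff_left)
  qed
  then show ?thesis by (simp add: op_le_def)
qed

context
  assumes le: "op_le K B (id_op K)"
begin

lemma row_contraction_norm_sq_le:
  assumes "x \<in> K"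
  shows "(norm (B x))\<^sup>2 \<le> inner (B x) x"
proof (rule positive_contraction_norm_sq_le[of K])
  show "inner (B x) y = inner x (B y)" if "x \<in> K" "y \<in> K" for x y
    using strong_sum_inner[OF that] strong_sum_inner[OF that(2,1)]
    by (simp add: inner_commute) (metis has_sum_unique inner_commute)
  show "0 \<le> inner (B x) x" if "x \<in> K" for x
    using strong_sum_norm[OF that] by (rule has_sum_nonneg) simp
qed (use K le assms in \<open>auto simp: op_le_id_iff strong_sum_diff strong_sum_in csubspace_diff
      closed_csubspace_def\<close>)

text \<open>
  Being fixed by \<open>B\<close> is a condition on norms: it says that \<open>\<Sum>i. \<parallel>(S i)* x\<parallel>\<^sup>2\<close> attains its upper
  bound \<open>\<parallel>x\<parallel>\<^sup>2\<close>.  Such a condition is preserved under isometries that intertwine the adjoints.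
\<close>

lemma row_contraction_fixed_iff:
  assumes "x \<in> K"
  shows "B x = x \<longleftrightarrow> inner x x \<le> inner (B x) x"
  using positive_contraction_fixed[of B x, OF row_contraction_norm_sq_le[OF assms]] le assms
  by (force simp: op_le_id_iff)

lemma row_contraction_norm_le:
  assumes "x \<in> K"
  shows "norm (B x) \<le> norm x"
proof -
  have "(norm (B x))\<^sup>2 \<le> inner x x"
    using row_contraction_norm_sq_le[OF assms] le assms by (force simp: op_le_id_iff)
  then show ?thesis by (simp add: power2_norm_eq_inner[symmetric])
qed

lemma closed_csubspace_fixed: "closed_csubspace {x \<in> K. B x = x}"
  unfolding closed_csubspace_def
proof
  have cs: "csubspace K" and cl: "closed K" using K by (auto simp: closed_csubspace_def)
  have scale: "B (c *\<^sub>C x) = c *\<^sub>C x" if x: "x \<in> K" "B x = x" for c x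
  proof -
    have cx: "c *\<^sub>C x \<in> K" using cs x by (simp add: csubspace_scaleC)
    have "((\<lambda>i. (cmod c)\<^sup>2 * (norm (adj K (S i) x))\<^sup>2) has_sum (cmod c)\<^sup>2 * inner (B x) x) J"
      using strong_sum_norm[OF x(1)] by (rule has_sum_cmult_right)
    moreover have "(norm (adj K (S i) (c *\<^sub>C x)))\<^sup>2 = (cmod c)\<^sup>2 * (norm (adj K (S i) x))\<^sup>2"
      if "i \<in> J" for i
      using adj_scaleC[OF K S[OF that] x(1)] by (simp add: norm_scaleC power_mult_distrib)
    ultimately have "((\<lambda>i. (norm (adj K (S i) (c *\<^sub>C x)))\<^sup>2) has_sum (cmod c)\<^sup>2 * inner (B x) x) J"
      by (auto elim!: has_sum_eq_rhs)
    then have "inner (B (c *\<^sub>C x)) (c *\<^sub>C x) = (cmod c)\<^sup>2 * inner x x"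
      using strong_sum_norm[OF cx] has_sum_unique x(2) by metis
    then show ?thesis
      unfolding row_contraction_fixed_iff[OF cx]
      by (simp add: norm_scaleC power_mult_distrib flip: power2_norm_eq_inner)
  qed
  have add: "B (x + y) = x + y" if "x \<in> K" "B x = x" "y \<in> K" "B y = y" for x y
    using strong_sum_diff[of x "(- 1) *\<^sub>C y"] scale[of y "- 1"] csubspace_scaleC[of K y "- 1"] cs that
    by (simp add: scaleC_minus_one)
  show "csubspace {x \<in> K. B x = x}"
    using cs scale add strong_sum_diff[of 0 0] unfolding csubspace_def by auto
  show "closed {x \<in> K. B x = x}"
    unfolding closed_sequential_limits
  proof (intro allI impI, elim conjE)
    fix X l assume X: "\<forall>n. X n \<in> {x \<in> K. B x = x}" and l: "X \<longlonglongrightarrow> l"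
    have lK: "l \<in> K" using closed_sequentially[OF cl _ l] X by blast
    have "(\<lambda>n. B (X n) - B l) \<longlonglongrightarrow> 0"
    proof (rule Lim_null_comparison)
      show "\<forall>\<^sub>F n in sequentially. norm (B (X n) - B l) \<le> norm (X n - l)"
        using X lK row_contraction_norm_le[OF csubspace_diff[OF cs _ lK]]
        by (auto simp: strong_sum_diff intro!: always_eventually)
           (metis strong_sum_diff)
      show "(\<lambda>n. norm (X n - l)) \<longlonglongrightarrow> 0"
        using l by (simp add: LIM_zero tendsto_norm_zero)
    qed
    then have "X \<longlonglongrightarrow> B l" using X by (simp add: LIM_zero_iff)
    then show "l \<in> {x \<in> K. B x = x}" using l lK LIMSEQ_unique by auto
  qed
qed

text \<open>
  If \<open>(S i)* (S i)\<close> is a projection, then \<open>\<parallel>(S i)* (S i) z\<parallel> = \<parallel>S i z\<parallel>\<close>, so the single summand \<open>i\<close>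
  already exhausts \<open>\<parallel>S i z\<parallel>\<^sup>2\<close>.
\<close>

lemma range_fixed:
  assumes i: "i \<in> J" and z: "z \<in> K"
    and idem: "compose K (star_mult K (S i)) (star_mult K (S i)) = star_mult K (S i)"
  shows "B (S i z) = S i z"
proof -
  have Sz: "S i z \<in> K" using bounded_operatorD(1)[OF S[OF i] z] .
  let ?Q = "star_mult K (S i)"
  have Q: "?Q z = adj K (S i) (S i z)" using z by (simp add: star_mult_def compose_def)
  have QK: "?Q z \<in> K" using adj_in[OF K S[OF i] Sz] by (simp add: Q)
  have "?Q (?Q z) = ?Q z" using fun_cong[OF idem, of z] z by (simp add: compose_def)
  then have "cinner (?Q z) (?Q z) = cinner (S i z) (S i z)"
    using cinner_star_mult[OF K S[OF i]] QK z by (metis cinner_commute)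
  then have "inner (S i z) (S i z) = (norm (adj K (S i) (S i z)))\<^sup>2"
    by (metis Q Re_cinner power2_norm_eq_inner)
  also have "\<dots> \<le> inner (B (S i z)) (S i z)"
    using finite_sum_le_has_sum[OF strong_sum_norm[OF Sz], of "{i}"] i by simp
  finally show ?thesis using row_contraction_fixed_iff[OF Sz] by simp
qed

end

end

lemma coisometric_iff_fixed:
  assumes B: "strong_has_sum K (\<lambda>i. mult_star K (S i)) (idx n) B"
  shows "coisometric K n S \<longleftrightarrow> (\<forall>x\<in>K. B x = x)"
proof
  assume "coisometric K n S"
  then show "\<forall>x\<in>K. B x = x"
    using B unfolding coisometric_def strong_has_sum_def id_op_def
    by (metis has_sum_unique restrict_apply')
next
  assume "\<forall>x\<in>K. B x = x"
  then show "coisometric K n S"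
    using B by (simp add: coisometric_def strong_has_sum_def id_op_def)
qed

section \<open>Coisometric tuples and their minimal dilations\<close>

lemma lin_isometryI:
  assumes add: "\<And>x y. V (x + y) = V x + V y" and scale: "\<And>c x. V (c *\<^sub>C x) = c *\<^sub>C V x"
    and norm: "\<And>x. norm (V x) = norm x"
  shows "lin_isometry V"
proof -
  have "inner (V x) (V y) = inner x y" for x y
    by (simp add: dot_norm norm flip: add)
  then have "cinner (V x) (V y) = cinner x y" for x y
    by (intro cinner_eqI) (simp flip: scale)
  then show ?thesis using add scale by (simp add: lin_isometry_def)
qed

lemma lin_isometryD:
  assumes "lin_isometry V"
  shows "V (x + y) = V x + V y" "V (c *\<^sub>C x) = c *\<^sub>C V x" "cinner (V x) (V y) = cinner x y"
    "inner (V x) (V y) = inner x y" "norm (V x) = norm x"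
proof -
  have *: "V (x + y) = V x + V y" "V (c *\<^sub>C x) = c *\<^sub>C V x" "cinner (V x) (V y) = cinner x y" for x y c
    using assms by (auto simp: lin_isometry_def)
  show "V (x + y) = V x + V y" "V (c *\<^sub>C x) = c *\<^sub>C V x" "cinner (V x) (V y) = cinner x y"
    by fact+
  show i: "inner (V x) (V y) = inner x y" for x y using *(3) by (metis Re_cinner)
  show "norm (V x) = norm x" by (simp add: norm_eq_sqrt_inner i)
qed

lemma closed_cspan_minimal:
  assumes "X \<subseteq> F" "closed_csubspace F"
  shows "closed_cspan X \<subseteq> F"
  using assms unfolding closed_cspan_def closed_csubspace_def
  by (intro closure_minimal hull_minimal) auto

lemma foldr_in:
  assumes "set w \<subseteq> J" "x \<in> K" "\<And>i x. i \<in> J \<Longrightarrow> x \<in> K \<Longrightarrow> S i x \<in> K"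
  shows "foldr S w x \<in> K"
  using assms by (induction w) auto

text \<open>
  As \<open>(S i)* V = V (T i)*\<close>, the sums for \<open>S\<close> at \<open>V h\<close> and for \<open>T\<close> at \<open>h\<close> have the same norms, so
  \<open>B\<close> fixes \<open>V h\<close> iff \<open>C\<close> fixes \<open>h\<close>.  If \<open>C\<close> is the identity, the closed subspace fixed by \<open>B\<close>
  contains \<open>V h\<close> for all \<open>h\<close> and the ranges of all \<open>S i\<close>, and by minimality these span \<open>K\<close>.
\<close>

lemma minimal_dilation_coisometric_iff:
  fixes T :: "nat \<Rightarrow> 'h::chilbert_space \<Rightarrow> 'h" and S :: "nat \<Rightarrow> 'k::chilbert_space \<Rightarrow> 'k"
  assumes T: "nonzero_tuple UNIV n T" "row_contraction UNIV n T"
    and dil: "minimal_dilation K V n S T"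
  shows "coisometric K n S \<longleftrightarrow> coisometric UNIV n T"
proof -
  note UN = closed_csubspace_UNIV
  from dil have K: "closed_csubspace K" and V: "lin_isometry V" and VK: "V h \<in> K"
    and dag: "dagger K n S"
    and inv: "i \<in> idx n \<Longrightarrow> adj K (S i) (V h) = V (adj UNIV (T i) h)"
    and span: "K = closed_cspan (range V \<union> (\<Union>w\<in>lists (idx n) - {[]}. foldr S w ` range V))"
    for i h
    unfolding minimal_dilation_def Let_def by auto
  have cs: "csubspace K" using K by (simp add: closed_csubspace_def)
  from dag have S: "bounded_operator K (S i)"
    and idem: "compose K (star_mult K (S i)) (star_mult K (S i)) = star_mult K (S i)"
    if "i \<in> idx n" for i
    using that by (auto simp: dagger_def nonzero_tuple_def)
  from dag obtain B where B: "strong_has_sum K (\<lambda>i. mult_star K (S i)) (idx n) B"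
    and B_le: "op_le K B (id_op K)"
    by (auto simp: dagger_def row_contraction_def)
  from T have T_op: "bounded_operator UNIV (T i)" if "i \<in> idx n" for i
    using that by (auto simp: nonzero_tuple_def)
  from T obtain C where C: "strong_has_sum UNIV (\<lambda>i. mult_star UNIV (T i)) (idx n) C"
    and C_le: "op_le UNIV C (id_op UNIV)"
    by (auto simp: row_contraction_def)
  have "inner (B (V h)) (V h) = inner (C h) h" for h
  proof -
    have "((\<lambda>i. (norm (adj UNIV (T i) h))\<^sup>2) has_sum inner (B (V h)) (V h)) (idx n)"
      by (rule has_sum_eq_rhs[OF strong_sum_norm[OF K S B VK, of h]])
         (simp_all add: inv lin_isometryD(5)[OF V])
    then show ?thesis
      using strong_sum_norm[OF UN T_op C, of h] has_sum_unique by blast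
  qed
  then have fixed_iff: "B (V h) = V h \<longleftrightarrow> C h = h" for h
    using row_contraction_fixed_iff[OF K S B B_le VK, of h]
      row_contraction_fixed_iff[OF UN T_op C C_le, of h] lin_isometryD(4)[OF V, of h h]
    by simp
  have "(\<forall>x\<in>K. B x = x) \<longleftrightarrow> (\<forall>h. C h = h)"
  proof
    assume "\<forall>x\<in>K. B x = x"
    then show "\<forall>h. C h = h" using VK fixed_iff by simp
  next
    assume h: "\<forall>h. C h = h"
    let ?F = "{x \<in> K. B x = x}"
    have F: "closed_csubspace ?F"
      using closed_csubspace_fixed[OF K S B B_le] by simp
    have "range V \<union> (\<Union>w\<in>lists (idx n) - {[]}. foldr S w ` range V) \<subseteq> ?F"
    proof (intro Un_least UN_least)
      show "range V \<subseteq> ?F" using VK h fixed_iff by auto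
      fix w assume w: "w \<in> lists (idx n) - {[]}"
      then obtain i u where iu: "w = i # u" "i \<in> idx n" "set u \<subseteq> idx n"
        by (cases w) auto
      have z: "foldr S u (V h) \<in> K" for h
        using iu VK bounded_operatorD(1)[OF S] by (intro foldr_in) auto
      show "foldr S w ` range V \<subseteq> ?F"
        using iu range_fixed[OF K S B B_le iu(2) z idem[OF iu(2)]]
          bounded_operatorD(1)[OF S[OF iu(2)] z] by auto
    qed
    then have "K \<subseteq> ?F"
      using F by (subst span) (rule closed_cspan_minimal)
    then show "\<forall>x\<in>K. B x = x" by blast
  qed
  then show ?thesis
    using coisometric_iff_fixed[OF B] coisometric_iff_fixed[OF C] by simp
qed

section \<open>Minimal dilations by isometries with orthogonal ranges\<close>

lemma csubspace_hull: "csubspace (csubspace hull X)"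
  by (rule hull_in) (auto simp: csubspace_def)

lemma tendsto_scaleC:
  assumes "X \<longlonglongrightarrow> l"
  shows "(\<lambda>n. c *\<^sub>C X n) \<longlonglongrightarrow> c *\<^sub>C l"
proof -
  have "bounded_linear (\<lambda>x::'a. c *\<^sub>C x)"
  proof (rule bounded_linear_intro[where K = "cmod c"])
    show "c *\<^sub>C r *\<^sub>R x = r *\<^sub>R c *\<^sub>C x" for r and x :: 'a
      by (simp add: scaleC_scaleC mult.commute flip: scaleC_of_real)
  qed (simp_all add: scaleC_add_right norm_scaleC mult.commute)
  then show ?thesis using assms by (rule bounded_linear.tendsto)
qed

lemma closed_csubspace_closed_cspan: "closed_csubspace (closed_cspan X)"
proof -
  let ?L = "csubspace hull X"
  have L: "csubspace ?L" by (rule csubspace_hull)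
  have "csubspace (closure ?L)"
  proof (rule csubspace_def[THEN iffD2], intro conjI ballI allI)
    show "0 \<in> closure ?L" using csubspace_0[OF L] closure_subset by blast
  next
    fix x y assume "x \<in> closure ?L" "y \<in> closure ?L"
    then obtain X Y where "\<And>n. X n \<in> ?L" "X \<longlonglongrightarrow> x" "\<And>n. Y n \<in> ?L" "Y \<longlonglongrightarrow> y"
      unfolding closure_sequential by blast
    then show "x + y \<in> closure ?L"
      unfolding closure_sequential
      by (intro exI[of _ "\<lambda>n. X n + Y n"]) (simp add: csubspace_add[OF L] tendsto_add)
  next
    fix c x assume "x \<in> closure ?L"
    then obtain X where "\<And>n. X n \<in> ?L" "X \<longlonglongrightarrow> x"
      unfolding closure_sequential by blast
    then show "c *\<^sub>C x \<in> closure ?L"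
      unfolding closure_sequential
      by (intro exI[of _ "\<lambda>n. c *\<^sub>C X n"]) (simp add: csubspace_scaleC[OF L] tendsto_scaleC)
  qed
  then show ?thesis by (simp add: closed_csubspace_def closed_cspan_def)
qed

lemma closed_cspan_superset: "X \<subseteq> closed_cspan X"
  unfolding closed_cspan_def by (meson closure_subset hull_subset order_trans)

text \<open>
  For isometries with orthogonal ranges all initial projections are the identity, which makes most
  of the relations immediate.  The strong convergence of the sum of the range projections is
  Bessel's inequality.
\<close>

lemma orthogonal_isometries_dagger:
  fixes K :: "'k::chilbert_space set"
  assumes n: "n > 0" and K: "closed_csubspace K" and nontriv: "k \<in> K" "k \<noteq> 0"
    and S: "\<And>i. i \<in> idx n \<Longrightarrow> bounded_operator K (S i)"
    and orth: "\<And>i j x y. i \<in> idx n \<Longrightarrow> j \<in> idx n \<Longrightarrow> x \<in> K \<Longrightarrow> y \<in> K \<Longrightarrow>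
      inner (S i x) (S j y) = (if i = j then inner x y else 0)"
  shows "dagger K n S" and "i \<in> idx n \<Longrightarrow> star_mult K (S i) = id_op K"
proof -
  have cs: "csubspace K" using K by (simp add: closed_csubspace_def)
  have star: "star_mult K (S i) = id_op K" if i: "i \<in> idx n" for i
  proof
    fix y
    have "adj K (S i) (S i y) = y" if y: "y \<in> K"
    proof (rule adj_eqI[OF cs])
      show "cinner (S i x) (S i y) = cinner x y" if x: "x \<in> K" for x
        using orth[OF i i csubspace_scaleC[OF cs x] y] bounded_operatorD(3)[OF S[OF i] x]
        by (intro cinner_eqI) simp
    qed (use y bounded_operatorD(1)[OF S[OF i]] in auto)
    then show "star_mult K (S i) y = id_op K y"
      by (simp add: star_mult_def compose_def id_op_def restrict_def)
  qed
  show "i \<in> idx n \<Longrightarrow> star_mult K (S i) = id_op K" by (rule star)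
  let ?P = "\<lambda>i. mult_star K (S i)"
  have adjK: "adj K (S i) x \<in> K" if "i \<in> idx n" "x \<in> K" for i x
    using adj_in[OF K S] that by blast
  have P: "?P i x = S i (adj K (S i) x)" if "x \<in> K" for i x
    using that by (simp add: mult_star_def compose_def)
  have norm_P: "norm (?P i x) = norm (adj K (S i) x)" if "i \<in> idx n" "x \<in> K" for i x
    using orth[OF that(1,1) adjK[OF that] adjK[OF that]] that
    by (simp add: P norm_eq_sqrt_inner)
  have P_orth: "inner (?P i x) (?P j x) = 0" if "i \<in> idx n" "j \<in> idx n" "i \<noteq> j" "x \<in> K" for i j x
    using that by (simp add: P orth adjK)
  have P_inner: "inner (?P i x) x = (norm (adj K (S i) x))\<^sup>2" if "i \<in> idx n" "x \<in> K" for i x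
    using adj_inner[OF K S[OF that(1)] adjK[OF that] that(2)] that
    by (simp add: P power2_norm_eq_inner)
  have bessel: "(\<Sum>i\<in>F. (norm (adj K (S i) x))\<^sup>2) \<le> (norm x)\<^sup>2"
    if F: "finite F" "F \<subseteq> idx n" and x: "x \<in> K" for F x
  proof -
    define y s where "y = (\<Sum>i\<in>F. ?P i x)" and "s = (\<Sum>i\<in>F. (norm (adj K (S i) x))\<^sup>2)"
    have "(norm y)\<^sup>2 = (\<Sum>i\<in>F. (norm (?P i x))\<^sup>2)"
      unfolding y_def using F x
      by (intro norm_sum_Pythagorean) (auto simp: pairwise_def orthogonal_def intro!: P_orth)
    also have "\<dots> = s" unfolding s_def using F x by (intro sum.cong) (auto simp: norm_P)
    finally have y: "(norm y)\<^sup>2 = s" .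
    have "inner y x = s"
      unfolding y_def s_def inner_sum_left using F x by (intro sum.cong) (auto simp: P_inner)
    then have "(norm y)\<^sup>2 \<le> norm y * norm x"
      using y norm_cauchy_schwarz[of y x] by simp
    then have "norm y \<le> norm x"
      by (cases "norm y = 0") (auto simp: power2_eq_square)
    then show ?thesis using y unfolding s_def by (metis norm_ge_zero power_mono)
  qed
  have "(\<lambda>i. ?P i x) summable_on idx n" if x: "x \<in> K" for x
  proof (rule orthogonal_square_summable_imp_summable)
    show "(\<Sum>i\<in>F. (norm (?P i x))\<^sup>2) \<le> (norm x)\<^sup>2" if F: "finite F" "F \<subseteq> idx n" for F
    proof -
      have "(\<Sum>i\<in>F. (norm (?P i x))\<^sup>2) = (\<Sum>i\<in>F. (norm (adj K (S i) x))\<^sup>2)"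
        using F x by (intro sum.cong) (auto simp: norm_P)
      then show ?thesis using bessel[OF F x] by simp
    qed
  qed (use P_orth x in auto)
  then have B: "strong_has_sum K ?P (idx n) (\<lambda>x. infsum (\<lambda>i. ?P i x) (idx n))"
    by (simp add: strong_has_sum_def)
  have "op_le K (\<lambda>x. infsum (\<lambda>i. ?P i x) (idx n)) (id_op K)"
  proof (rule op_le_id_iff[OF K S B, THEN iffD2], simp_all, rule ballI)
    fix x assume x: "x \<in> K"
    show "inner (infsum (\<lambda>i. ?P i x) (idx n)) x \<le> inner x x"
      using has_sum_le_finite_sums[OF strong_sum_norm[OF K S B x] bessel[OF _ _ x]]
      by (simp add: power2_norm_eq_inner)
  qed
  then have row: "row_contraction K n S" using B by (auto simp: row_contraction_def)
  have le: "op_le K (?P i) (id_op K)" if i: "i \<in> idx n" for i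
    unfolding op_le_def
  proof
    fix x assume x: "x \<in> K"
    have "(norm (adj K (S i) x))\<^sup>2 \<le> (norm x)\<^sup>2" using bessel[of "{i}" x] i x by simp
    moreover have "cinner (id_op K x - ?P i x) x = of_real ((norm x)\<^sup>2 - (norm (adj K (S i) x))\<^sup>2)"
      using x cinner_mult_star[OF K S[OF i] x x]
      by (simp add: id_op_def cinner_diff_left cinner_self)
    ultimately show "cinner (id_op K x - ?P i x) x \<in> \<real>\<^sub>\<ge>\<^sub>0"
      by (simp add: complex_nonneg_Reals_iff del: of_real_diff)
  qed
  have nonzero: "S i \<noteq> zero_op K" if i: "i \<in> idx n" for i
    using orth[OF i i nontriv(1) nontriv(1)] nontriv by (auto simp: zero_op_def)
  have "0 \<in> idx n" using n by (simp add: idx_def zero_enat_def)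
  then have img: "(\<lambda>i. star_mult K (S i)) ` idx n = {id_op K}" using star by auto
  have id: "compose K (id_op K) (id_op K) = id_op K"
    by (auto simp: compose_def id_op_def restrict_def)
  show "dagger K n S"
    unfolding dagger_def img
    using star id row le nonzero S
    by (auto simp: nonzero_tuple_def strong_has_sum_def intro!: has_sum_finiteI)
qed

text \<open>
  Minimality is obtained by restriction to the closed span \<open>K\<close> of the words applied to the range of
  \<open>V\<close>.  This span is invariant under \<open>W\<close>, and the restricted operators are still isometries with
  orthogonal ranges.  The adjoints of the restrictions need not be computed on all of \<open>K\<close>: on the
  range of \<open>V\<close> they are given by \<open>coinv\<close>.  The isometries are only required on a closed subspace
  \<open>M\<close>, so that they may live on a summand of the ambient space.  The vector \<open>h\<close> serves to make the
  isometries non-zero.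
\<close>

lemma minimal_dilation_of_isometries:
  fixes V :: "'h::chilbert_space \<Rightarrow> 'k::chilbert_space" and W :: "nat \<Rightarrow> 'k \<Rightarrow> 'k"
  assumes n: "n > 0" and h: "(h::'h) \<noteq> 0"
    and V: "lin_isometry V" and M: "closed_csubspace M" and VM: "range V \<subseteq> M"
    and WM: "\<And>i x. i \<in> idx n \<Longrightarrow> x \<in> M \<Longrightarrow> W i x \<in> M"
    and add: "\<And>i x y. i \<in> idx n \<Longrightarrow> x \<in> M \<Longrightarrow> y \<in> M \<Longrightarrow> W i (x + y) = W i x + W i y"
    and scale: "\<And>i x c. i \<in> idx n \<Longrightarrow> x \<in> M \<Longrightarrow> W i (c *\<^sub>C x) = c *\<^sub>C W i x"
    and orth: "\<And>i j x y. i \<in> idx n \<Longrightarrow> j \<in> idx n \<Longrightarrow> x \<in> M \<Longrightarrow> y \<in> M \<Longrightarrow>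
      inner (W i x) (W j y) = (if i = j then inner x y else 0)"
    and coinv: "\<And>i x h. i \<in> idx n \<Longrightarrow> x \<in> M \<Longrightarrow>
      inner (W i x) (V h) = inner x (V (adj UNIV (T i) h))"
  shows "\<exists>K S. minimal_dilation K V n S T"
proof -
  define G where "G = range V \<union> (\<Union>w\<in>lists (idx n) - {[]}. foldr W w ` range V)"
  define K where "K = closed_cspan G"
  define S where "S i = restrict (W i) K" for i
  have K: "closed_csubspace K" unfolding K_def by (rule closed_csubspace_closed_cspan)
  have cs: "csubspace K" and cl: "closed K" using K by (auto simp: closed_csubspace_def)
  have GK: "G \<subseteq> K" unfolding K_def by (rule closed_cspan_superset)
  have "G \<subseteq> M"
    unfolding G_def using VM by (force intro!: foldr_in[of _ "idx n"] WM)
  then have KM: "K \<subseteq> M" unfolding K_def using M by (rule closed_cspan_minimal)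
  have WK: "W i x \<in> K" if i: "i \<in> idx n" and x: "x \<in> K" for i x
  proof -
    let ?F = "{x \<in> K. W i x \<in> K}"
    have "G \<subseteq> ?F"
    proof
      fix g assume g: "g \<in> G"
      have "\<exists>w\<in>lists (idx n). \<exists>h. g = foldr W w (V h)"
        using g unfolding G_def by (force intro: bexI[of _ "[]"])
      then obtain w h where w: "g = foldr W w (V h)" "w \<in> lists (idx n)" by blast
      then have "W i g \<in> G"
        unfolding G_def using i by (intro UnI2 UN_I[of "i # w"]) auto
      then show "g \<in> ?F" using g GK by auto
    qed
    moreover have "closed_csubspace ?F"
      unfolding closed_csubspace_def
    proof
      have "W i 0 = 0" using scale[OF i, of 0 0] csubspace_0[of M] M
        by (simp add: closed_csubspace_def scaleC_of_real[of 0, simplified])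
      then show "csubspace ?F"
        using cs KM unfolding csubspace_def by (auto simp: add[OF i] scale[OF i] subset_iff)
      show "closed ?F"
        unfolding closed_sequential_limits
      proof (intro allI impI, elim conjE)
        fix X l assume X: "\<forall>n. X n \<in> ?F" and l: "X \<longlonglongrightarrow> l"
        have lK: "l \<in> K" using closed_sequentially[OF cl _ l] X by blast
        have "norm (W i (X n) - W i l) = norm (X n - l)" for n
        proof -
          have m: "X n - l \<in> M" "X n \<in> M" "l \<in> M"
            using X lK KM csubspace_diff[OF cs] by blast+
          then have "W i (X n) = W i (X n - l) + W i l" using add[OF i m(1) m(3)] by simp
          then show ?thesis using orth[OF i i m(1) m(1)] by (simp add: norm_eq_sqrt_inner)
        qed
        then have "(\<lambda>n. norm (W i (X n) - W i l)) \<longlonglongrightarrow> 0"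
          using l by (simp add: LIM_zero tendsto_norm_zero)
        then have "(\<lambda>n. W i (X n)) \<longlonglongrightarrow> W i l"
          by (rule LIM_zero_cancel[OF tendsto_norm_zero_cancel])
        then have "W i l \<in> K" by (rule closed_sequentially[OF cl, rotated]) (use X in auto)
        then show "l \<in> ?F" using lK by simp
      qed
    qed
    ultimately have "K \<subseteq> ?F" using closed_cspan_minimal unfolding K_def by blast
    then show ?thesis using x by blast
  qed
  have VK: "V h \<in> K" for h using GK by (auto simp: G_def)
  have S_op: "bounded_operator K (S i)" if i: "i \<in> idx n" for i
  proof -
    have "norm (W i x) \<le> 1 * norm x" if "x \<in> K" for x
      using orth[OF i i, of x x] that KM by (simp add: norm_eq_sqrt_inner subset_iff)
    then have "\<exists>B. \<forall>x\<in>K. norm (S i x) \<le> B * norm x" unfolding S_def by (metis restrict_apply')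
    then show ?thesis
      using i cs KM unfolding bounded_operator_def S_def
      by (auto simp: WK add scale csubspace_add csubspace_scaleC subset_iff)
  qed
  have S_orth: "inner (S i x) (S j y) = (if i = j then inner x y else 0)"
    if "i \<in> idx n" "j \<in> idx n" "x \<in> K" "y \<in> K" for i j x y
    using that KM orth[of i j x y] by (simp add: S_def subset_iff)
  have Vh: "V h \<noteq> 0" using h lin_isometryD(5)[OF V, of h] by auto
  have dag: "dagger K n S"
    by (rule orthogonal_isometries_dagger(1)[OF n K VK Vh S_op S_orth])
  have star: "star_mult K (S i) = id_op K" if "i \<in> idx n" for i
    by (rule orthogonal_isometries_dagger(2)[OF n K VK Vh S_op S_orth that])
  have coinv': "adj K (S i) (V h) = V (adj UNIV (T i) h)" if i: "i \<in> idx n" for i h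
  proof (rule adj_eqI[OF cs VK VK])
    fix x assume x: "x \<in> K"
    show "cinner (S i x) (V h) = cinner x (V (adj UNIV (T i) h))"
      using coinv[OF i, of _ h] x KM csubspace_scaleC[OF cs x] scale[OF i, symmetric]
      by (intro cinner_eqI) (auto simp: S_def subset_iff)
  qed
  have words: "foldr S w (V h) = foldr W w (V h)" if "w \<in> lists (idx n)" for w h
    using that
  proof (induction w)
    case (Cons i w)
    then have "foldr W w (V h) \<in> K" by (intro foldr_in[of _ "idx n"] VK WK) auto
    then show ?case using Cons by (auto simp: S_def)
  qed simp
  have "G = range V \<union> (\<Union>w\<in>lists (idx n) - {[]}. foldr S w ` range V)"
    unfolding G_def by (intro arg_cong2[where f = "(\<union>)"] SUP_cong refl image_cong)
       (auto intro!: words[symmetric])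
  then have span: "K = closed_cspan (range V \<union> (\<Union>w\<in>lists (idx n) - {[]}. foldr S w ` range V))"
    by (simp add: K_def)
  have red: "reduces K (star_mult K (S i)) (range V)" if "i \<in> idx n" for i
    unfolding reduces_def Let_def star[OF that] id_op_def image_subset_iff using VK by simp
  have "minimal_dilation K V n S T"
    unfolding minimal_dilation_def Let_def
    using K V VK dag red coinv' span by (auto simp: image_subset_iff)
  then show ?thesis by blast
qed

section \<open>Square-summable sequences\<close>

lemma ell2_nth_simps:
  "ell2_nth (x + y) i = ell2_nth x i + ell2_nth y i"
  "ell2_nth (x - y) i = ell2_nth x i - ell2_nth y i"
  by (transfer, simp)+

lemma ell2_nth_scaleC: "ell2_nth (c *\<^sub>C x) i = c *\<^sub>C ell2_nth x i"
  by transfer simp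

lemma ell2_eqI: "(\<And>i. ell2_nth x i = ell2_nth y i) \<Longrightarrow> x = y"
  by (simp add: ell2_nth_inject[symmetric] fun_eq_iff)

lift_definition single :: "nat \<Rightarrow> 'a::real_inner \<Rightarrow> 'a ell2" is "\<lambda>i x j. if j = i then x else 0"
  subgoal for i x by (rule summable_finite[of "{i}"]) auto
  done

lemma inner_single: "inner (single i x) y = inner x (ell2_nth y i)"
proof (transfer fixing: i x)
  fix y :: "nat \<Rightarrow> 'a"
  have "(\<Sum>j. inner (if j = i then x else 0) (y j)) = (\<Sum>j\<in>{i}. inner (if j = i then x else 0) (y j))"
    by (rule suminf_finite) auto
  then show "(\<Sum>j. inner (if j = i then x else 0) (y j)) = inner x (y i)" by simp
qed

lemma ell2_nth_single: "ell2_nth (single i x) j = (if j = i then x else 0)"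
  by transfer simp

lemma lin_isometry_single: "lin_isometry (single i)"
proof (rule lin_isometryI)
  show "single i (x + y) = single i x + single i y" for x y :: 'a
    by (rule ell2_eqI) (simp add: ell2_nth_simps ell2_nth_single)
  show "single i (c *\<^sub>C x) = c *\<^sub>C single i x" for c and x :: 'a
    by (rule ell2_eqI) (simp add: ell2_nth_scaleC ell2_nth_single scaleC_zero)
  show "norm (single i x) = norm x" for x :: 'a
    by (simp add: norm_eq_sqrt_inner inner_single ell2_nth_single)
qed

text \<open>
  The unitary from double to simple square-summable sequences.  It makes room for countably many
  orthogonal copies of the sequence space inside itself, the ranges of \<open>\<lambda>x. flatten (single i x)\<close>.
\<close>

definition flatten :: "'a::real_inner ell2 ell2 \<Rightarrow> 'a ell2" where
  "flatten x = Abs_ell2 (\<lambda>m. case prod_decode m of (i, j) \<Rightarrow> ell2_nth (ell2_nth x i) j)"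

lemma flatten_sums:
  "(\<lambda>m. (norm (case prod_decode m of (i, j) \<Rightarrow> ell2_nth (ell2_nth x i) j))\<^sup>2) sums (norm x)\<^sup>2"
proof -
  define f where "f = (\<lambda>(i, j). (norm (ell2_nth (ell2_nth x i) j))\<^sup>2)"
  have row: "((\<lambda>j. f (i, j)) has_sum (norm (ell2_nth x i))\<^sup>2) UNIV" for i
    unfolding f_def norm_ell2_sq[of "ell2_nth x i"]
    by (rule sums_nonneg_imp_has_sum) (auto intro: summable_sums ell2_nth_summable)
  have rows: "((\<lambda>i. (norm (ell2_nth x i))\<^sup>2) has_sum (norm x)\<^sup>2) UNIV"
    unfolding norm_ell2_sq[of x]
    by (rule sums_nonneg_imp_has_sum) (auto intro: summable_sums ell2_nth_summable)
  have "f summable_on (UNIV \<times> UNIV)"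
    by (rule summable_on_SigmaI[OF row has_sum_imp_summable[OF rows]]) (simp add: f_def)
  from has_sum_SigmaI[OF row rows this] have "(f has_sum (norm x)\<^sup>2) UNIV" by simp
  then have "((\<lambda>m. f (prod_decode m)) has_sum (norm x)\<^sup>2) UNIV"
    using has_sum_reindex_bij_betw[OF bij_prod_decode, of f] by blast
  moreover have "(\<lambda>m. f (prod_decode m)) =
      (\<lambda>m. (norm (case prod_decode m of (i, j) \<Rightarrow> ell2_nth (ell2_nth x i) j))\<^sup>2)"
    by (auto simp: f_def split: prod.split)
  ultimately show ?thesis using has_sum_imp_sums by metis
qed

lemma ell2_nth_flatten:
  "ell2_nth (flatten x) m = (case prod_decode m of (i, j) \<Rightarrow> ell2_nth (ell2_nth x i) j)"
  unfolding flatten_def using sums_summable[OF flatten_sums[of x]] by (simp add: Abs_ell2_inverse)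

lemma lin_isometry_flatten: "lin_isometry flatten"
proof (rule lin_isometryI)
  show "flatten (x + y) = flatten x + flatten y" for x y :: "'a ell2 ell2"
    by (rule ell2_eqI) (simp add: ell2_nth_simps ell2_nth_flatten split: prod.split)
  show "flatten (c *\<^sub>C x) = c *\<^sub>C flatten x" for c and x :: "'a ell2 ell2"
    by (rule ell2_eqI) (simp add: ell2_nth_scaleC ell2_nth_flatten split: prod.split)
  have "(norm (flatten x))\<^sup>2 = (norm x)\<^sup>2" for x :: "'a ell2 ell2"
    unfolding norm_ell2_sq[of "flatten x"] ell2_nth_flatten
    by (rule sums_unique[symmetric, OF flatten_sums])
  then show "norm (flatten x) = norm x" for x :: "'a ell2 ell2" by simp
qed

section \<open>The isometric dilation of a row contraction\<close>

text \<open>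
  A substitute for the square root of \<open>B\<close>: an operator \<open>D\<close> with \<open>D* D = B\<close>, but with values in the
  larger space of sequences.  Put \<open>b 0 = B\<close> and \<open>b (k + 1) = b k - (b k)\<^sup>2\<close>.  These are positive
  contractions, and telescoping gives \<open>(b 0)\<^sup>2 + \<dots> + (b (N - 1))\<^sup>2 = B - b N\<close>.  Hence
  \<open>\<Sum>k. \<parallel>b k x\<parallel>\<^sup>2\<close> converges, so \<open>b N x\<close> tends to zero, and the sum is \<open>\<langle>B x, x\<rangle>\<close>.  Therefore
  \<open>D x = (b 0 x, b 1 x, \<dots>)\<close> is as required.
\<close>

lemma positive_contraction_factorization:
  fixes B :: "'a::complex_inner \<Rightarrow> 'a"
  assumes add: "\<And>x y. B (x + y) = B x + B y" and scale: "\<And>c x. B (c *\<^sub>C x) = c *\<^sub>C B x"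
    and symm: "\<And>x y. inner (B x) y = inner x (B y)"
    and pos: "\<And>x. 0 \<le> inner (B x) x" and contr: "\<And>x. inner (B x) x \<le> inner x x"
  shows "\<exists>D :: 'a \<Rightarrow> 'a ell2. (\<forall>x y. D (x + y) = D x + D y) \<and>
    (\<forall>c x. D (c *\<^sub>C x) = c *\<^sub>C D x) \<and> (\<forall>x y. inner (D x) (D y) = inner (B x) y)"
proof -
  define good where "good A \<longleftrightarrow> (\<forall>x y. A (x + y) = A x + A y) \<and> (\<forall>c x. A (c *\<^sub>C x) = c *\<^sub>C A x) \<and>
    (\<forall>x y. inner (A x) y = inner x (A y)) \<and> (\<forall>x. 0 \<le> inner (A x) x \<and> inner (A x) x \<le> inner x x)"
    for A :: "'a \<Rightarrow> 'a"
  have good_diff: "A (x - y) = A x - A y" if "good A" for A x y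
  proof -
    have "A (x + (- 1) *\<^sub>C y) = A x + (- 1) *\<^sub>C A y" using that unfolding good_def by metis
    then show ?thesis by (simp add: scaleC_minus_one)
  qed
  have good_step: "good (\<lambda>x. A x - A (A x))" if A: "good A" for A
  proof -
    have "(norm (A x))\<^sup>2 \<le> inner (A x) x" for x
      using A by (intro positive_contraction_norm_sq_le[of UNIV]) (auto simp: good_def good_diff[OF A])
    then have "inner (A (A x)) x \<le> inner (A x) x" "0 \<le> inner (A (A x)) x" for x
      using A unfolding good_def power2_norm_eq_inner by (metis, metis inner_ge_zero)
    moreover have "c *\<^sub>C (x - y) = c *\<^sub>C x - c *\<^sub>C y" for c and x y :: 'a
      using scaleC_add_right[of c "x - y" y] by simp
    ultimately show ?thesis
      using A unfolding good_def
      by (auto simp: inner_diff_left inner_diff_right intro: order_trans[rotated])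
  qed
  define b where "b k = ((\<lambda>A x. A x - A (A x)) ^^ k) B" for k
  have b_Suc: "b (Suc k) x = b k x - b k (b k x)" for k x by (simp add: b_def)
  have good_b: "good (b k)" for k
  proof (induction k)
    case 0
    then show ?case using assms by (simp add: b_def good_def)
  next
    case (Suc k)
    have "b (Suc k) = (\<lambda>x. b k x - b k (b k x))" by (auto simp: b_Suc)
    then show ?case using good_step[OF Suc] by simp
  qed
  note b = good_b[unfolded good_def]
  have partial: "(\<Sum>k<N. (norm (b k x))\<^sup>2) = inner (B x) x - inner (b N x) x" for N x
  proof (induction N)
    case (Suc N)
    have "inner (b N (b N x)) x = (norm (b N x))\<^sup>2"
      using b[of N] by (simp add: power2_norm_eq_inner)
    then show ?case using Suc by (simp add: b_Suc inner_diff_left)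
  qed (simp add: b_def)
  have summ: "summable (\<lambda>k. (norm (b k x))\<^sup>2)" for x
  proof (rule summableI_nonneg_bounded)
    show "(\<Sum>k<N. (norm (b k x))\<^sup>2) \<le> inner (B x) x" for N
    proof -
      have "0 \<le> inner (b N x) x" using b by blast
      then show ?thesis unfolding partial by linarith
    qed
  qed simp
  have sums: "(\<lambda>k. (norm (b k x))\<^sup>2) sums inner (B x) x" for x
  proof -
    have "(\<lambda>k. sqrt ((norm (b k x))\<^sup>2)) \<longlonglongrightarrow> sqrt 0"
      by (intro tendsto_real_sqrt summable_LIMSEQ_zero summ)
    then have "(\<lambda>k. b k x) \<longlonglongrightarrow> 0" by (simp add: tendsto_norm_zero_iff)
    then have "(\<lambda>N. inner (B x) x - inner (b N x) x) \<longlonglongrightarrow> inner (B x) x - inner 0 x"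
      by (intro tendsto_intros)
    then show ?thesis by (simp add: sums_def partial)
  qed
  define D where "D x = Abs_ell2 (\<lambda>k. b k x)" for x
  have nth_D: "ell2_nth (D x) k = b k x" for x k
    unfolding D_def using summ by (simp add: Abs_ell2_inverse)
  have D_add: "D (x + y) = D x + D y" for x y
    using b by (intro ell2_eqI) (simp add: nth_D ell2_nth_simps)
  have D_norm: "(norm (D x))\<^sup>2 = inner (B x) x" for x
    unfolding norm_ell2_sq nth_D by (rule sums_unique[symmetric, OF sums])
  show ?thesis
  proof (intro exI[of _ D] conjI allI)
    show "D (x + y) = D x + D y" for x y by (rule D_add)
    show "D (c *\<^sub>C x) = c *\<^sub>C D x" for c x
      using b by (intro ell2_eqI) (simp add: nth_D ell2_nth_scaleC)
    show "inner (D x) (D y) = inner (B x) y" for x y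
      unfolding dot_norm[of "D x"] D_add[symmetric] D_norm
      using symm[of y x] by (simp add: add inner_simps inner_commute)
  qed
qed

lemma real_adjoint_exists:
  fixes C :: "'a::{real_inner, complete_space} \<Rightarrow> 'b::real_inner"
  assumes "bounded_linear C"
  obtains C' where "\<And>x y. inner (C x) y = inner x (C' y)"
proof -
  interpret bounded_linear C by fact
  obtain c where c: "\<And>x. norm (C x) \<le> norm x * c" using bounded by blast
  have "\<exists>z\<in>UNIV. \<forall>x\<in>UNIV. inner (C x) y = inner x z" for y
  proof (rule Riesz_representation[where C = "c * norm y"])
    show "\<bar>inner (C x) y\<bar> \<le> c * norm y * norm x" for x
    proof -
      have "\<bar>inner (C x) y\<bar> \<le> norm (C x) * norm y" by (rule Cauchy_Schwarz_ineq2)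
      also have "\<dots> \<le> (norm x * c) * norm y" using c by (intro mult_right_mono) auto
      finally show ?thesis by (simp add: ac_simps)
    qed
  qed (auto simp: add scaleR inner_add_left)
  then have "\<forall>y. \<exists>z. \<forall>x. inner (C x) y = inner x z" by simp
  from choice[OF this] show thesis using that by blast
qed

text \<open>
  The operators \<open>D i\<close> are the columns of a defect operator of the row \<open>T\<close>.  The column
  \<open>C h = ((T i)* h)\<^sub>i\<close> of the adjoints is a contraction, and its adjoint \<open>C'\<close> is the row operator,
  that is, it maps the sequence with only entry \<open>x\<close> at \<open>i\<close> to \<open>T i x\<close>.  The factorization is applied
  to \<open>I - C C'\<close>, the square of the usual defect operator.
\<close>

lemma row_contraction_defect:
  fixes T :: "nat \<Rightarrow> 'h::chilbert_space \<Rightarrow> 'h"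
  assumes "nonzero_tuple UNIV n T" "row_contraction UNIV n T"
  obtains D :: "nat \<Rightarrow> 'h \<Rightarrow> 'h ell2" where
    "\<And>i x y. D i (x + y) = D i x + D i y" "\<And>i c x. D i (c *\<^sub>C x) = c *\<^sub>C D i x"
    "\<And>i j x y. i \<in> idx n \<Longrightarrow> j \<in> idx n \<Longrightarrow>
      inner (D i x) (D j y) = (if i = j then inner x y else 0) - inner (T i x) (T j y)"
proof -
  note UN = closed_csubspace_UNIV
  from assms have T: "bounded_operator UNIV (T i)" if "i \<in> idx n" for i
    using that by (auto simp: nonzero_tuple_def)
  from assms obtain R where R: "strong_has_sum UNIV (\<lambda>i. mult_star UNIV (T i)) (idx n) R"
    and R_le: "op_le UNIV R (id_op UNIV)"
    by (auto simp: row_contraction_def)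
  define c where "c h i = (if i \<in> idx n then adj UNIV (T i) h else 0)" for h i
  have partial: "(\<Sum>i<N. (norm (c h i))\<^sup>2) \<le> (norm h)\<^sup>2" for h N
  proof -
    have "(\<Sum>i<N. (norm (c h i))\<^sup>2) = (\<Sum>i\<in>{..<N} \<inter> idx n. (norm (adj UNIV (T i) h))\<^sup>2)"
      by (intro sum.mono_neutral_cong_right) (auto simp: c_def)
    also have "\<dots> \<le> inner (R h) h"
      by (rule finite_sum_le_has_sum[OF strong_sum_norm[OF UN T R]]) auto
    also have "\<dots> \<le> (norm h)\<^sup>2"
      using R_le op_le_id_iff[OF UN T R] by (simp add: power2_norm_eq_inner)
    finally show ?thesis .
  qed
  have summ: "summable (\<lambda>i. (norm (c h i))\<^sup>2)" for h
    using partial by (intro summableI_nonneg_bounded) auto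
  define C where "C h = Abs_ell2 (c h)" for h
  have nth_C: "ell2_nth (C h) i = c h i" for h i
    unfolding C_def using summ by (simp add: Abs_ell2_inverse)
  have C_add: "C (x + y) = C x + C y" for x y
    by (rule ell2_eqI) (simp add: nth_C ell2_nth_simps c_def adj_add[OF UN T])
  have C_scale: "C (a *\<^sub>C x) = a *\<^sub>C C x" for a x
    by (rule ell2_eqI) (simp add: nth_C ell2_nth_scaleC c_def adj_scaleC[OF UN T] scaleC_zero)
  have "(norm (C h))\<^sup>2 \<le> (norm h)\<^sup>2" for h
    unfolding norm_ell2_sq nth_C using partial summ by (intro suminf_le_const) auto
  then have C_norm: "norm (C h) \<le> norm h" for h by simp
  have C_scaleR: "C (r *\<^sub>R x) = r *\<^sub>R C x" for r x
    using C_scale[of "complex_of_real r" x] by (simp add: scaleC_of_real)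
  have "bounded_linear C"
    using C_norm by (intro bounded_linear_intro[where K = 1]) (auto simp: C_add C_scaleR)
  then obtain C' where C': "\<And>x y. inner (C x) y = inner x (C' y)"
    using real_adjoint_exists by blast
  have inner_ext: "u = v" if "\<And>x. inner x u = inner x v" for u v :: 'h
  proof -
    have "inner (u - v) (u - v) = 0" using that[of "u - v"] by (simp add: inner_diff_right)
    then show ?thesis by simp
  qed
  have inner_scaleC: "inner x (a *\<^sub>C y) = inner (cnj a *\<^sub>C x) y" for a and x y :: "'b::complex_inner"
    by (simp add: cinner_scaleC_right cinner_scaleC_left flip: Re_cinner)
  have C'_add: "C' (x + y) = C' x + C' y" for x y
    by (rule inner_ext) (simp add: inner_add_right flip: C')
  have C'_scale: "C' (a *\<^sub>C x) = a *\<^sub>C C' x" for a x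
  proof (rule inner_ext)
    fix z
    have "inner z (C' (a *\<^sub>C x)) = inner (cnj a *\<^sub>C C z) x" by (simp add: inner_scaleC flip: C')
    also have "\<dots> = inner z (a *\<^sub>C C' x)" by (simp add: inner_scaleC C' flip: C_scale)
    finally show "inner z (C' (a *\<^sub>C x)) = inner z (a *\<^sub>C C' x)" .
  qed
  have C'_norm: "norm (C' x) \<le> norm x" for x
  proof -
    have "(norm (C' x))\<^sup>2 = inner (C (C' x)) x" by (simp add: C' power2_norm_eq_inner)
    also have "\<dots> \<le> norm (C (C' x)) * norm x" by (rule norm_cauchy_schwarz)
    also have "\<dots> \<le> norm (C' x) * norm x" using C_norm by (intro mult_right_mono) auto
    finally show ?thesis by (cases "norm (C' x) = 0") (auto simp: power2_eq_square)
  qed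
  have C'_single: "C' (single i x) = T i x" if i: "i \<in> idx n" for i x
  proof (rule inner_ext)
    fix z
    have "inner z (C' (single i x)) = inner (single i x) (C z)"
      by (metis C' inner_commute)
    also have "\<dots> = inner x (adj UNIV (T i) z)"
      using i by (simp add: inner_single nth_C c_def)
    also have "\<dots> = inner z (T i x)"
      using adj_inner[OF UN T[OF i], of x z] by (metis UNIV_I inner_commute)
    finally show "inner z (C' (single i x)) = inner z (T i x)" .
  qed
  define B where "B x = x - C (C' x)" for x
  have B_inner: "inner (B x) y = inner x y - inner (C' x) (C' y)" for x y
    by (simp add: B_def inner_diff_left C')
  have B_add: "B (x + y) = B x + B y" for x y by (simp add: B_def C'_add C_add)
  have B_scale: "B (a *\<^sub>C x) = a *\<^sub>C B x" for a x
  proof -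
    have "a *\<^sub>C (u - v) + a *\<^sub>C v = a *\<^sub>C u" for u v :: "'h ell2"
      by (simp flip: scaleC_add_right)
    then show ?thesis by (simp add: B_def C'_scale C_scale algebra_simps)
  qed
  have B_symm: "inner (B x) y = inner x (B y)" for x y
    by (metis B_inner inner_commute)
  have B_pos: "0 \<le> inner (B x) x" for x
    unfolding B_inner using power_mono[OF C'_norm[of x], of 2] by (simp add: power2_norm_eq_inner)
  have B_contr: "inner (B x) x \<le> inner x x" for x by (simp add: B_inner)
  obtain D :: "'h ell2 \<Rightarrow> 'h ell2 ell2" where
    D: "\<And>x y. D (x + y) = D x + D y" "\<And>c x. D (c *\<^sub>C x) = c *\<^sub>C D x"
    "\<And>x y. inner (D x) (D y) = inner (B x) y"
    using positive_contraction_factorization[OF B_add B_scale B_symm B_pos B_contr] by blast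
  show thesis
  proof (rule that[of "\<lambda>i x. flatten (D (single i x))"])
    fix i j x y assume ij: "i \<in> idx n" "j \<in> idx n"
    show "inner (flatten (D (single i x))) (flatten (D (single j y))) =
        (if i = j then inner x y else 0) - inner (T i x) (T j y)"
      using ij by (simp add: lin_isometryD(4)[OF lin_isometry_flatten] D(3) B_inner C'_single
          inner_single ell2_nth_single)
  qed (simp_all add: lin_isometryD(1,2)[OF lin_isometry_flatten]
      lin_isometryD(1,2)[OF lin_isometry_single] D)
qed

text \<open>
  The space of \<open>T\<close> is entry 0 of a sequence; the operators \<open>E j\<close> embed countably many further
  copies of the sequence space, with ranges orthogonal to each other and to entry 0.  On entry 0,
  \<open>W i\<close> acts as \<open>T i\<close>, with the lost norm restored by \<open>D i\<close> in the copy \<open>E 0\<close>, which is common to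
  all \<open>i\<close> because the defects must also cancel the inner products \<open>\<langle>T i x, T j y\<rangle>\<close> for \<open>i \<noteq> j\<close>.
  The remaining entries \<open>P x\<close> are shifted isometrically to the copy \<open>E (i + 1)\<close>.
\<close>

lemma isometric_dilation_exists:
  fixes T :: "nat \<Rightarrow> 'h::chilbert_space \<Rightarrow> 'h"
  assumes "nonzero_tuple UNIV n T" "row_contraction UNIV n T"
  obtains W :: "nat \<Rightarrow> 'h ell2 \<Rightarrow> 'h ell2" where
    "\<And>i x y. i \<in> idx n \<Longrightarrow> W i (x + y) = W i x + W i y"
    "\<And>i c x. i \<in> idx n \<Longrightarrow> W i (c *\<^sub>C x) = c *\<^sub>C W i x"
    "\<And>i j x y. i \<in> idx n \<Longrightarrow> j \<in> idx n \<Longrightarrow>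
      inner (W i x) (W j y) = (if i = j then inner x y else 0)"
    "\<And>i x h. i \<in> idx n \<Longrightarrow> inner (W i x) (single 0 h) = inner x (single 0 (adj UNIV (T i) h))"
proof -
  note UN = closed_csubspace_UNIV
  note sI = lin_isometryD[OF lin_isometry_single]
  from assms have T: "bounded_operator UNIV (T i)" if "i \<in> idx n" for i
    using that by (auto simp: nonzero_tuple_def)
  obtain D :: "nat \<Rightarrow> 'h \<Rightarrow> 'h ell2" where D:
    "\<And>i x y. D i (x + y) = D i x + D i y" "\<And>i c x. D i (c *\<^sub>C x) = c *\<^sub>C D i x"
    "\<And>i j x y. i \<in> idx n \<Longrightarrow> j \<in> idx n \<Longrightarrow>
      inner (D i x) (D j y) = (if i = j then inner x y else 0) - inner (T i x) (T j y)"
    using row_contraction_defect[OF assms] by blast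
  define E where "E j x = flatten (single (Suc j) x)" for j and x :: "'h ell2"
  have E_add: "E j (x + y) = E j x + E j y" and E_scale: "E j (c *\<^sub>C x) = c *\<^sub>C E j x" for j x y c
    by (simp_all add: E_def sI lin_isometryD[OF lin_isometry_flatten])
  have E_inner: "inner (E j x) (E k y) = (if j = k then inner x y else 0)" for j k x y
    by (simp add: E_def lin_isometryD[OF lin_isometry_flatten] inner_single ell2_nth_single)
  \<comment> \<open>Entry 0 belongs to copy 0 under the pairing, and \<open>E\<close> only uses the copies from 1 on.\<close>
  have "prod_decode 0 = (0, 0)" by (simp add: prod_decode_def prod_decode_aux.simps)
  then have E_0: "inner (single 0 h) (E j x) = 0" for h j x
    by (simp add: E_def inner_single ell2_nth_flatten ell2_nth_single zero_ell2.rep_eq)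
  then have E_0': "inner (E j x) (single 0 h) = 0" for h j x by (metis inner_commute)
  define P where "P x = x - single 0 (ell2_nth x 0)" for x :: "'h ell2"
  have P_inner: "inner (P x) (P y) = inner x y - inner (ell2_nth x 0) (ell2_nth y 0)" for x y
    unfolding P_def inner_diff_left inner_diff_right
    by (simp add: inner_single ell2_nth_single inner_commute[of x])
      (simp add: inner_commute)
  have P_add: "P (x + y) = P x + P y" for x y by (simp add: P_def ell2_nth_simps sI)
  have P_scale: "P (c *\<^sub>C x) = c *\<^sub>C P x" for c x
  proof -
    have "c *\<^sub>C (u - v) + c *\<^sub>C v = c *\<^sub>C u" for u v :: "'h ell2"
      by (simp flip: scaleC_add_right)
    then show ?thesis by (simp add: P_def ell2_nth_scaleC sI algebra_simps)
  qed
  define W where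
    "W i x = single 0 (T i (ell2_nth x 0)) + E 0 (D i (ell2_nth x 0)) + E (Suc i) (P x)" for i x
  show thesis
  proof (rule that[of W])
    show "W i (x + y) = W i x + W i y" if "i \<in> idx n" for i x y
      by (simp add: W_def ell2_nth_simps bounded_operatorD(2)[OF T[OF that]] sI D E_add P_add)
    show "W i (c *\<^sub>C x) = c *\<^sub>C W i x" if "i \<in> idx n" for i c x
      by (simp add: W_def ell2_nth_scaleC bounded_operatorD(3)[OF T[OF that]] sI D E_scale P_scale
          scaleC_add_right)
    show "inner (W i x) (W j y) = (if i = j then inner x y else 0)"
      if "i \<in> idx n" "j \<in> idx n" for i j x y
      using that
      by (simp add: W_def inner_add_left inner_add_right E_inner E_0 E_0' sI P_inner D)
    show "inner (W i x) (single 0 h) = inner x (single 0 (adj UNIV (T i) h))"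
      if "i \<in> idx n" for i x h
    proof -
      have "inner (W i x) (single 0 h) = inner (T i (ell2_nth x 0)) h"
        by (simp add: W_def inner_add_left E_0' sI)
      also have "\<dots> = inner (ell2_nth x 0) (adj UNIV (T i) h)"
        using adj_inner[OF UN T[OF that]] by simp
      also have "\<dots> = inner x (single 0 (adj UNIV (T i) h))"
        by (metis inner_commute inner_single)
      finally show ?thesis .
    qed
  qed
qed

text \<open>
  The isometric dilation on square-summable sequences, placed in the second factor of the ambient
  space.
\<close>

lemma minimal_dilation_exists:
  fixes T :: "nat \<Rightarrow> 'h::chilbert_space \<Rightarrow> 'h"
  assumes n: "n > 0" and T: "nonzero_tuple UNIV n T" "row_contraction UNIV n T"
  obtains K :: "('k::chilbert_space, 'h) ambient set" and V S where "minimal_dilation K V n S T"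
proof -
  have "0 \<in> idx n" using n by (simp add: idx_def zero_enat_def)
  then have "T 0 \<noteq> zero_op UNIV" using T by (simp add: nonzero_tuple_def)
  then obtain h where "T 0 h \<noteq> 0" by (auto simp: zero_op_def fun_eq_iff)
  moreover have "T 0 0 = 0"
    using T \<open>0 \<in> idx n\<close> bounded_operatorD(3)[of UNIV "T 0" 0 0]
    by (simp add: nonzero_tuple_def scaleC_of_real[of 0, simplified])
  ultimately have h: "h \<noteq> 0" by auto
  obtain W :: "nat \<Rightarrow> 'h ell2 \<Rightarrow> 'h ell2" where W:
    "\<And>i x y. i \<in> idx n \<Longrightarrow> W i (x + y) = W i x + W i y"
    "\<And>i c x. i \<in> idx n \<Longrightarrow> W i (c *\<^sub>C x) = c *\<^sub>C W i x"
    "\<And>i j x y. i \<in> idx n \<Longrightarrow> j \<in> idx n \<Longrightarrow>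
      inner (W i x) (W j y) = (if i = j then inner x y else 0)"
    "\<And>i x h. i \<in> idx n \<Longrightarrow> inner (W i x) (single 0 h) = inner x (single 0 (adj UNIV (T i) h))"
    using isometric_dilation_exists[OF T] by blast
  define M :: "('k, 'h) ambient set" where "M = {0} \<times> UNIV"
  have "\<exists>K S. minimal_dilation (K :: ('k, 'h) ambient set) (\<lambda>h. (0, single 0 h)) n S T"
  proof (rule minimal_dilation_of_isometries[OF n h, where M = M and W = "\<lambda>i x. (0, W i (snd x))"])
    show "lin_isometry (\<lambda>h::'h. (0, single 0 h) :: ('k, 'h) ambient)"
      using lin_isometryD[OF lin_isometry_single]
      by (intro lin_isometryI) (auto simp: scaleC_prod_def scaleC_zero norm_Pair)
    show "closed_csubspace M"
      by (auto simp: M_def closed_csubspace_def csubspace_def scaleC_prod_def scaleC_zero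
          zero_prod_def closed_Times)
  qed (auto simp: M_def W scaleC_prod_def scaleC_zero)
  then show thesis using that by blast
qed

theorem corollary3p7:
  fixes n :: enat
    and T :: "nat \<Rightarrow> 'h::chilbert_space \<Rightarrow> 'h"
  assumes "n > 0"
    and "nonzero_tuple UNIV n T"
    and "row_contraction UNIV n T"
  shows "(\<forall>(K :: ('k::chilbert_space, 'h) ambient set) V S.
            minimal_dilation K V n S T \<longrightarrow> fully_coisometric K n S)
         \<longleftrightarrow> coisometric UNIV n T"
proof -
  have iff: "fully_coisometric K n S \<longleftrightarrow> coisometric UNIV n T"
    if "minimal_dilation K V n S T" for K :: "('k, 'h) ambient set" and V S
    using minimal_dilation_coisometric_iff[OF assms(2,3) that] that
    by (auto simp: fully_coisometric_def minimal_dilation_def Let_def)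
  obtain K :: "('k, 'h) ambient set" and V S where "minimal_dilation K V n S T"
    using minimal_dilation_exists[OF assms] .
  then show ?thesis using iff by blast
qed

end
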